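(* Let $X$ be a tree and let $p$ be the least prime number greater than $End(X)$. If a continuous map $f:X\to X$ has cycles of all periods from $1$ to $2\,End(X)(p-1)$, then $f$ has cycles of all periods.
   Context: A graph is a compact one-dimensional branched manifold (a finite topological graph); a tree is a connected graph containing no subset homeomorphic to the circle. $End(X)$ denotes the number of endpoints of $X$. A cycle is the orbit of a periodic point, and its period is the number of points in it (the least period). *)

theory Defs
  imports "HOL-Analysis.Analysis" "HOL-Combinatorics.Orbits" "HOL-Computational_Algebra.Primes"
begin

definition open_star :: "nat \<Rightarrow> complex set" where
  "open_star n =
    {of_real t * cis (2 * pi * real j / real n) | t j. 0 \<le> t \<and> t < 1 \<and> j < n}"

text \<open>
  A point of valence \<open>n\<close> is the centre of a chart onto the open star with \<open>n\<close> branches. Valence 2 is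
  the manifold case. Requiring \<open>n \<ge> 1\<close> excludes isolated points, so that a space all of whose points
  have a valence is of pure dimension one.
\<close>

definition has_valence :: "'a topology \<Rightarrow> 'a \<Rightarrow> nat \<Rightarrow> bool" where
  "has_valence X x n \<longleftrightarrow>
    n \<ge> 1 \<and>
    (\<exists>U g. openin X U \<and> x \<in> U \<and>
       homeomorphic_map (subtopology X U) (top_of_set (open_star n)) g \<and> g x = 0)"

text \<open>
  Metrizability need not be demanded: a compact Hausdorff space covered by such charts is second
  countable.
\<close>

definition topological_graph :: "'a topology \<Rightarrow> bool" where
  "topological_graph X \<longleftrightarrow>
    compact_space X \<and> Hausdorff_space X \<and> (\<forall>x \<in> topspace X. \<exists>n. has_valence X x n)"

text \<open>The library counts the empty space as connected, hence the explicit nonemptiness.\<close>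

definition topological_tree :: "'a topology \<Rightarrow> bool" where
  "topological_tree X \<longleftrightarrow>
    topological_graph X \<and> topspace X \<noteq> {} \<and> connected_space X \<and>
    \<not> (\<exists>S \<subseteq> topspace X. subtopology X S homeomorphic_space top_of_set (sphere (0::complex) 1))"

definition End :: "'a topology \<Rightarrow> nat" where
  "End X = card {x \<in> topspace X. has_valence X x 1}"

definition periodic_point :: "('a \<Rightarrow> 'a) \<Rightarrow> 'a \<Rightarrow> bool" where
  "periodic_point f x \<longleftrightarrow> (\<exists>n > 0. (f ^^ n) x = x)"

text \<open>
  The library's \<^const>\<open>orbit\<close> starts at \<open>f x\<close>; for a periodic point \<open>x\<close> it is the full forward orbit.
\<close>

definition is_cycle :: "'a topology \<Rightarrow> ('a \<Rightarrow> 'a) \<Rightarrow> 'a set \<Rightarrow> bool" where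
  "is_cycle X f C \<longleftrightarrow> (\<exists>x \<in> topspace X. periodic_point f x \<and> C = orbit f x)"

definition has_cycle_of_period :: "'a topology \<Rightarrow> ('a \<Rightarrow> 'a) \<Rightarrow> nat \<Rightarrow> bool" where
  "has_cycle_of_period X f n \<longleftrightarrow> (\<exists>C. is_cycle X f C \<and> card C = n)"

end

theory Submission
  imports Defs "HOL-Number_Theory.Cong"
begin

text \<open>
  Let \<open>p\<close> be a prime greater than \<open>End X\<close> and let \<open>P\<close> be a cycle of period \<open>p\<close>. Since \<open>End X \<ge> 1\<close>, the
  number \<open>p\<close> is among the periods that are given, so the theorem follows from the claim that \<open>P\<close> forces all
  periods \<open>N > 2 End X (p - 1)\<close> (lemma \<open>prime_period_forces_large_periods\<close>).

  The cycle has a pivot \<open>h\<close> (\<open>pivot_exists\<close>): \<open>h\<close> separates two points of \<open>P\<close>, and \<open>f h\<close> lies in no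
  component of \<open>X - {h}\<close> that meets \<open>P\<close>. Order the tree by \<open>x \<le> y\<close> if \<open>x\<close> lies on the arc from \<open>h\<close> to \<open>y\<close>.
  Because of the condition on \<open>f h\<close> the image of the arc from \<open>h\<close> to \<open>w \<in> P\<close> covers the arc from \<open>h\<close> to
  \<open>f w\<close>, hence the arc from \<open>h\<close> to \<open>w'\<close> for every \<open>w' \<le> f w\<close>. So every closed walk of length \<open>N\<close> in the graph
  on \<open>P\<close> with the arrows \<open>w' \<le> f w\<close> is shadowed, and gives a point \<open>t\<close> with \<open>f\<^sup>N t = t\<close> that visits the
  components of \<open>X - {h}\<close> in the order of the walk (\<open>closed_walk_gives_periodic_point\<close>).

  The graph contains the cycle \<open>P\<close> itself, and through one of its points a closed walk of length
  \<open>l \<le> End X < p\<close>, because the minimal elements of \<open>P\<close> are at most \<open>End X\<close> in number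
  (\<open>antichain_card_le_End\<close>) and each of them has an arrow to another minimal element or to itself. As \<open>p\<close> is
  prime, \<open>l\<close> and \<open>p\<close> are coprime, and every \<open>N > 2 End X (p - 1)\<close> is the length of a concatenation
  of copies of the first walk and of copies of the second. The sequence of components visited by it
  is not a proper power (\<open>two_block_word_primitive\<close>), since \<open>h\<close> separates \<open>P\<close>; hence \<open>N\<close> is the least period
  of \<open>t\<close>.

  The existence of \<open>h\<close> and of \<open>t\<close> is one and the same fixed point argument (\<open>maximal_expanding_point\<close>), a
  search for a maximal point that is moved away from the root. On the topological side the absence of
  circles enters through the uniqueness of arcs (\<open>arc_unique_without_circle\<close>), by which a point on the arc
  between two points separates them (\<open>tree_seg_eq_arc\<close>).
\<close>

section \<open>Words that consist of two periodic blocks\<close>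

text \<open>
  The theorem of Fine and Wilf. The periods are treated by Euclid's algorithm: if \<open>p < q\<close>, then on the
  word shortened by \<open>p\<close> letters \<open>q - p\<close> is a period too, with the same greatest common divisor.
\<close>

lemma fine_wilf:
  fixes u :: "nat \<Rightarrow> 'b"
  assumes "\<And>i. i + p < n \<Longrightarrow> u (i + p) = u i" "\<And>i. i + q < n \<Longrightarrow> u (i + q) = u i"
    and "0 < p" "0 < q" "p + q \<le> n + gcd p q"
  shows "i + gcd p q < n \<Longrightarrow> u (i + gcd p q) = u i"
  using assms
proof (induction "p + q" arbitrary: p q n i rule: less_induct)
  case less
  have main: "u (i + gcd p q) = u i"
    if pq: "p < q" and per: "\<And>i. i + p < n \<Longrightarrow> u (i + p) = u i" "\<And>i. i + q < n \<Longrightarrow> u (i + q) = u i"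
      and n: "0 < p" "p + q \<le> n + gcd p q" and i: "i + gcd p q < n"
      and IH: "\<And>p' q' n i. \<lbrakk>p' + q' < p + q; i + gcd p' q' < n; \<And>i. i + p' < n \<Longrightarrow> u (i + p') = u i;
          \<And>i. i + q' < n \<Longrightarrow> u (i + q') = u i; 0 < p'; 0 < q'; p' + q' \<le> n + gcd p' q'\<rbrakk> \<Longrightarrow> u (i + gcd p' q') = u i"
    for p q i n
  proof -
    let ?g = "gcd p q"
    have g: "gcd p (q - p) = ?g" using pq gcd_diff1_nat[of p q] by (simp add: gcd.commute)
    have gp: "?g \<le> p" "0 < ?g" using n(1) by (auto simp: gcd_le1_nat)
    have "?g dvd q - p" by simp
    then have gqp: "?g \<le> q - p" using pq by (simp add: dvd_imp_le)
    \<comment> \<open>on the shorter word the difference of the periods is a period as well\<close>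
    have short: "u (j + ?g) = u j" if "j + ?g < n - p" for j
    proof -
      have "u (j + gcd p (q - p)) = u j"
      proof (rule IH[where n = "n - p"])
        show "u (k + (q - p)) = u k" if "k + (q - p) < n - p" for k
          using per(2)[of k] per(1)[of "k + (q - p)"] that pq by (simp add: add.assoc)
      qed (use that g pq n per(1) in auto)
      then show ?thesis using g by simp
    qed
    show ?thesis
    proof (cases "i + ?g < n - p")
      case True then show ?thesis by (rule short)
    next
      case False
      have "p \<le> i + ?g" using False n gqp pq by linarith
      show ?thesis
      proof (cases "p \<le> i")
        case True
        have "u (i + ?g) = u (i - p + ?g)" using per(1)[of "i - p + ?g"] True i by simp
        also have "\<dots> = u (i - p)" 
        proof (rule short)
          show "i - p + ?g < n - p" using True i by linarith
        qed
        also have "\<dots> = u i" using per(1)[of "i - p"] True i by simp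
        finally show ?thesis .
      next
        case False': False
        \<comment> \<open>\<open>i\<close> lies just below \<open>p\<close>: step down by multiples of the gcd inside the short word\<close>
        have "u (i + ?g) = u (i + ?g - p)" using per(1)[of "i + ?g - p"] \<open>p \<le> i + ?g\<close> i by simp
        moreover obtain m where m: "p = ?g * Suc m" 
          using n(1) by (metis dvd_def gcd_dvd1 not0_implies_Suc mult_0_right less_numeral_extra(3))
        have "u (j + ?g * k) = u j" if "j + ?g * k < n - p" for j k
          using that
        proof (induction k)
          case (Suc k)
          then show ?case using short[of "j + ?g * k"] by (simp add: add.commute add.left_commute)
        qed simp
        note this[of "i + ?g - p" m]
        moreover have "i + ?g - p + ?g * m = i" using m \<open>p \<le> i + ?g\<close> by simp
        moreover have "i < n - p" using False' n gqp pq by linarith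
        ultimately show ?thesis by simp
      qed
    qed
  qed
  consider "p = q" | "p < q" | "q < p" by linarith
  then show ?case
  proof cases
    case 1 then show ?thesis using less.prems by simp
  next
    case 2
    show ?thesis by (rule main[OF 2 less.prems(2,3,4,6,1) less.hyps])
  next
    case 3
    have "u (i + gcd q p) = u i"
      using less.prems(6,1)
      by (intro main[OF 3 less.prems(3,2,5) _ _ less.hyps[unfolded add.commute[of p q]]])
        (auto simp: add.commute[of q p] gcd.commute[of q p])
    then show ?thesis by (simp add: gcd.commute)
  qed
qed

text \<open>
  The factor of length \<open>n\<close> starting at position \<open>s\<close> has the period \<open>q\<close>. Words are kept as factors of one
  infinite sequence, so that blocks can be compared without being copied.
\<close>

definition periodic_on :: "(nat \<Rightarrow> 'b) \<Rightarrow> nat \<Rightarrow> nat \<Rightarrow> nat \<Rightarrow> bool" where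
  "periodic_on u s n q \<longleftrightarrow> (\<forall>i. i + q < n \<longrightarrow> u (s + i + q) = u (s + i))"

lemma fine_wilf_on:
  assumes "periodic_on u s n p" "periodic_on u s n q" "0 < p" "0 < q" "p + q \<le> n + gcd p q"
  shows "periodic_on u s n (gcd p q)"
  unfolding periodic_on_def
  using fine_wilf[of p n "\<lambda>i. u (s + i)" q] assms unfolding periodic_on_def by (simp add: add.assoc)

lemma periodic_on_mult:
  assumes "periodic_on u s n q" shows "periodic_on u s n (q * k)"
  unfolding periodic_on_def
proof (induction k)
  case (Suc k)
  show ?case
  proof (intro allI impI)
    fix i assume i: "i + q * Suc k < n"
    have "u (s + (i + q * k) + q) = u (s + (i + q * k))"
      using assms[unfolded periodic_on_def, rule_format, of "i + q * k"] i by (simp add: ac_simps)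
    moreover have "i + q * k < n" using i by simp
    then have "u (s + i + q * k) = u (s + i)" using Suc by blast
    ultimately show "u (s + i + q * Suc k) = u (s + i)" by (simp add: ac_simps)
  qed
qed simp

lemma periodic_on_subword:
  assumes "periodic_on u s n q" "s \<le> s'" "s' + n' \<le> s + n"
  shows "periodic_on u s' n' q"
  unfolding periodic_on_def
proof (intro allI impI)
  fix i assume "i + q < n'"
  then show "u (s' + i + q) = u (s' + i)"
    using assms(1)[unfolded periodic_on_def, rule_format, of "s' - s + i"] assms(2,3) by simp
qed

text \<open>
  A \<open>d\<close>-periodic sequence is a repetition of any of its factors of length \<open>d\<close>. Hence a divisor of \<open>d\<close> that
  is a period of such a factor is a period of the whole sequence.
\<close>

lemma periodic_everywhere:
  assumes "\<And>i. u (i + d) = u i" "e dvd d" "0 < d" "periodic_on u s n e" "d \<le> n"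
  shows "u (i + e) = u i"
proof -
  obtain k where k: "d = e * k" using assms(2) by blast
  then have ek: "0 < e" "0 < k" using assms(3) by auto
  have mul: "u (i + d * j) = u i" for i j
  proof (induction j)
    case (Suc j)
    then show ?case using assms(1)[of "i + d * j"] by (simp add: ac_simps)
  qed simp
  \<comment> \<open>move \<open>i\<close> into the window of length \<open>d\<close> starting at \<open>s\<close>\<close>
  obtain r where r: "r < d" "\<And>x. u (i + x) = u (s + r + x)"
  proof -
    let ?r = "(i + s * (d - 1)) mod d"
    have "(s + ?r) mod d = (i + s * d) mod d"
      using assms(3) by (metis (no_types, lifting) add.assoc add.commute mod_add_right_eq mult_Suc_right Suc_pred')
    then have m: "(s + ?r) mod d = i mod d" by simp
    have "u (i + x) = u (s + ?r + x)" for x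
    proof -
      have "u y = u (y mod d)" for y using mul[of "y mod d" "y div d"] by simp
      moreover have "(i + x) mod d = (s + ?r + x) mod d" using m by (metis mod_add_left_eq)
      ultimately show ?thesis by metis
    qed
    then show ?thesis using that[of ?r] assms(3) by simp
  qed
  show ?thesis
  proof (cases "r + e < d")
    case True
    then show ?thesis using r(2)[of e] r(2)[of 0] assms(4,5) unfolding periodic_on_def by simp
  next
    case False
    have shift: "r + e - d + e * (k - 1) = r" using False k ek by (cases k) auto
    have "u (s + r + e) = u (s + (r + e - d))"
      using assms(1)[of "s + (r + e - d)"] False by (simp add: add.assoc)
    also have "\<dots> = u (s + (r + e - d) + e * (k - 1))"
      using periodic_on_mult[OF assms(4), of "k - 1", unfolded periodic_on_def, rule_format, of "r + e - d"]
        shift r(1) assms(5) by simp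
    also have "s + (r + e - d) + e * (k - 1) = s + r" using shift by simp
    finally show ?thesis using r(2)[of e] r(2)[of 0] by simp
  qed
qed

text \<open>
  This is a quantitative relative of the theorem of Lyndon and Schuetzenberger on the equation
  \<open>x\<^sup>a y\<^sup>b = z\<^sup>c\<close>. The sequence \<open>u\<close> begins with a power of a word of length \<open>p\<close>, followed by a power of
  a word of length \<open>l\<close>, together of length \<open>N\<close>; if it has a period that is a proper divisor \<open>d\<close> of \<open>N\<close>,
  then it is constant on the first \<open>p\<close> letters.

  If one of the blocks is long enough compared with \<open>d\<close>, then Fine and Wilf make a divisor of its period
  a period of the whole sequence, and coprimality of \<open>p\<close> and \<open>l\<close> reduces that to the period 1. If both
  blocks are too short for this, then the length condition leaves only \<open>N = 2 d\<close>. In that case the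
  shift by \<open>d\<close> moves the shorter block into the longer one, so that it has both periods, hence period 1.
\<close>

lemma two_block_word_primitive:
  fixes u :: "nat \<Rightarrow> 'b"
  assumes per: "\<And>i. u (i + d) = u i" and d: "0 < d" "d dvd N" "d < N"
    and N: "N = A + B" "p dvd A" "l dvd B" "0 < A" "0 < B"
    and cop: "coprime p l" "0 < l" "l < p"
    and bA: "periodic_on u 0 A p" and bB: "periodic_on u A B l"
    and long: "3 * (p + l) \<le> N + 6"
    and big: "(p + l \<le> A + 1 \<and> p + l \<le> B + 1) \<or> N + 2 * l \<le> 2 * B + 2"
    and i: "i < p"
  shows "u i = u 0"
proof -
  have p: "0 < p" "1 < p" using cop by auto
  have pA: "p \<le> A" using N(2,4) by (simp add: dvd_imp_le)
  \<comment> \<open>a letter repeated through \<open>p\<close> consecutive places of the first block settles the claim\<close>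
  have const: ?thesis if c: "periodic_on u s n 1" "p \<le> n" "s + n \<le> A" for s n
  proof -
    have c1: "u (s + j) = u s" if "j < n" for j
      using periodic_on_mult[OF c(1), of j] that unfolding periodic_on_def
      by (metis add_0 add_cancel_right_right nat_mult_1)
    have c2: "\<exists>j<p. u r = u (s + j)" if r: "r < p" for r
    proof -
      have mul: "u (x + p * k) = u x" if "x + p * k < A" for x k
        using periodic_on_mult[OF bA, of k] that unfolding periodic_on_def by auto
      let ?j = "(r + s * (p - 1)) mod p"
      have "(s + ?j) mod p = (r + s * p) mod p"
        using p by (metis (no_types, lifting) add.assoc add.commute mod_add_right_eq mult_Suc_right Suc_pred')
      then have "(s + ?j) mod p = r" using r by simp
      moreover have "?j < p" using p by simp
      moreover have "u (s + ?j) = u ((s + ?j) mod p)"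
        using mul[of "(s + ?j) mod p" "(s + ?j) div p"] \<open>?j < p\<close> c(2,3) by simp
      ultimately show ?thesis by metis
    qed
    show ?thesis using c1 c2[OF i] c2[OF p(1)] c(2) by (metis order_less_le_trans)
  qed
  have perd: "periodic_on u s n d" for s n using per unfolding periodic_on_def by simp
  consider (lam) "d + l \<le> B + 1" | (gam) "d + p \<le> A + 1" | (half) "\<not> d + l \<le> B + 1" "\<not> d + p \<le> A + 1"
    by blast
  then show ?thesis
  proof cases
    case lam
    let ?e = "gcd d l"
    have e: "0 < ?e" using cop by simp
    have "periodic_on u A B ?e" 
    proof (intro fine_wilf_on perd bB)
      show "d + l \<le> B + gcd d l" using lam e by linarith
    qed (use d cop in auto)
    then have all: "u (i + ?e) = u i" for i
      using per d(1) lam cop by (intro periodic_everywhere[of u d ?e A B]) auto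
    have "?e dvd N" "?e dvd B" using d(2) N(3) by (meson dvd_trans gcd_dvd1 gcd_dvd2)+
    then have eA: "?e dvd A" using N(1) by (simp add: dvd_add_left_iff)
    have ep: "coprime p ?e" using cop(1) by (meson coprime_divisors dvd_refl gcd_dvd2)
    have "periodic_on u 0 A 1"
    proof (cases "A = p")
      case True
      then have "?e = 1" using eA ep by (metis coprime_absorb_right is_unit_gcd gcd_nat.absorb_iff2 nat_dvd_1_iff_1)
      then show ?thesis using all unfolding periodic_on_def by simp
    next
      case False
      have "p * 2 \<le> A"
      proof -
        obtain k where "A = p * k" using N(2) by blast
        then have "k \<noteq> 0" "k \<noteq> 1" using False N(4) by auto
        then show ?thesis using \<open>A = p * k\<close> by simp
      qed
      moreover have "?e \<le> p" using gcd_le2_nat[of l d] cop(2,3) by linarith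
      moreover have "periodic_on u 0 A ?e" using all unfolding periodic_on_def by simp
      ultimately have "periodic_on u 0 A (gcd p ?e)" using p(1) e
        by (intro fine_wilf_on[of u 0 A p ?e] bA) linarith+
      then show ?thesis using ep by simp
    qed
    then show ?thesis using const[of 0 A] pA by simp
  next
    case gam
    let ?e = "gcd d p"
    have e: "0 < ?e" using p by simp
    have "periodic_on u 0 A ?e" 
    proof (intro fine_wilf_on perd bA)
      show "d + p \<le> A + gcd d p" using gam e by linarith
    qed (use d p in auto)
    then have all: "u (i + ?e) = u i" for i
      using per d(1) gam p by (intro periodic_everywhere[of u d ?e 0 A]) auto
    have "periodic_on u A B ?e" using all unfolding periodic_on_def by simp
    moreover have "?e dvd B" using d(2) N by (metis dvd_add_right_iff dvd_trans gcd_dvd1 gcd_dvd2)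
    moreover have el: "coprime ?e l" using cop(1) by (meson coprime_divisors dvd_refl gcd_dvd2)
    ultimately have "?e * l dvd B" using N(3) by (simp add: divides_mult)
    then have "?e * l \<le> B" using N(5) by (simp add: dvd_imp_le)
    moreover have "?e + l \<le> ?e * l + 1"
      using e cop(2) by (cases ?e; cases l) auto
    ultimately have "periodic_on u A B (gcd ?e l)"
      using \<open>periodic_on u A B ?e\<close> el e cop(2) by (intro fine_wilf_on[of u A B ?e l] bB) auto
    then have B1: "periodic_on u A B 1" using el by simp
    \<comment> \<open>the letters of one full \<open>?e\<close>-period agree, so the \<open>?e\<close>-periodic sequence is constant\<close>
    have "?e \<le> B" using \<open>?e * l \<le> B\<close> cop(2) by (metis le_trans mult_le_mono2 mult_1_right Suc_leI One_nat_def)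
    then have "u (i + 1) = u i" for i
      using all B1 e by (intro periodic_everywhere[of u ?e 1 A B]) auto
    then show ?thesis using const[of 0 A] pA unfolding periodic_on_def by simp
  next
    case half
    obtain k where k: "N = d * k" using d(2) by blast
    have "k \<noteq> 0" "k \<noteq> 1" using k d by auto
    moreover have "\<not> 3 \<le> k"
    proof
      assume "3 \<le> k"
      then have "3 * d \<le> N" using k by simp
      moreover have "B + 2 \<le> d + l" "A + 2 \<le> d + p" using half by simp_all
      ultimately show False using long unfolding N(1) by simp
    qed
    ultimately have "k = 2" by linarith
    then have N2: "N = 2 * d" using k by simp
    then have sz: "p + l \<le> A + 1" "p + l \<le> B + 1" using big half by auto
    show ?thesis
    proof (cases "B \<le> A")
      case True
      then have BdA: "B \<le> d" "d \<le> A" using N2 N(1) by auto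
      \<comment> \<open>half a turn carries the second block into the first\<close>
      have "periodic_on u (A - d) B l"
        unfolding periodic_on_def
      proof (intro allI impI)
        fix j assume "j + l < B"
        then have "u (A + j + l) = u (A + j)" using bB unfolding periodic_on_def by blast
        then show "u (A - d + j + l) = u (A - d + j)"
          using per[of "A - d + j + l"] per[of "A - d + j"] BdA by simp
      qed
      moreover have "periodic_on u (A - d) B p"
        using BdA N2 N(1) by (intro periodic_on_subword[OF bA]) auto
      ultimately have "periodic_on u (A - d) B (gcd p l)"
        using cop sz by (intro fine_wilf_on) auto
      then show ?thesis
        using const[of "A - d" B] cop sz BdA N2 N(1) by auto
    next
      case False
      then have AdB: "A \<le> d" "d \<le> B" using N2 N(1) by auto
      have "periodic_on u 0 A l"
        unfolding periodic_on_def
      proof (intro allI impI)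
        fix j assume j: "j + l < A"
        have "u (A + (d - A + j) + l) = u (A + (d - A + j))"
          using bB[unfolded periodic_on_def, rule_format, of "d - A + j"] j AdB N2 N(1) by simp
        then show "u (0 + j + l) = u (0 + j)"
          using per[of "j + l"] per[of j] AdB by (simp add: ac_simps)
      qed
      then have "periodic_on u 0 A (gcd p l)" using cop sz p by (intro fine_wilf_on bA) auto
      then show ?thesis using const[of 0 A] cop pA by auto
    qed
  qed
qed

text \<open>
  Lengths for which the previous lemma applies. The number \<open>a\<close> of blocks of length \<open>p\<close> is the solution of
  \<open>a p \<equiv> N (mod l)\<close> with \<open>1 \<le> a \<le> l\<close>; the bound \<open>N > 2 l (p - 1)\<close> then leaves room for at least \<open>p - 1\<close>
  blocks of length \<open>l\<close>.
\<close>

lemma two_block_decomposition: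
  fixes p l N :: nat
  assumes "coprime p l" "0 < l" "l < p" "3 \<le> p" "2 * l * (p - 1) < N" "4 * (p - 1) < N"
  obtains A B where "N = A + B" "p dvd A" "l dvd B" "0 < A" "0 < B" "3 * (p + l) \<le> N + 6"
    "(p + l \<le> A + 1 \<and> p + l \<le> B + 1) \<or> N + 2 * l \<le> 2 * B + 2"
proof -
  obtain x where x: "[p * x = 1] (mod l)" using cong_solve_coprime_nat[OF assms(1)] by auto
  define a where "a = (if x * N mod l = 0 then l else x * N mod l)"
  have a: "0 < a" "a \<le> l" using assms(2) unfolding a_def by (auto simp: less_imp_le)
  have "[a = x * N] (mod l)" unfolding a_def cong_def by auto
  then have "[a * p = x * N * p] (mod l)" by (rule cong_scalar_right)
  also have "x * N * p = p * x * N" by simp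
  also have "[p * x * N = 1 * N] (mod l)" using x by (rule cong_scalar_right)
  finally have cong: "[a * p = N] (mod l)" by simp
  have "l * p \<le> l * (2 * (p - 1))" using assms(4) by (intro mult_le_mono2) linarith
  also have "\<dots> = 2 * l * (p - 1)" by simp
  finally have "l * p < N" using assms(5) by linarith
  moreover have "a * p \<le> l * p" using a by simp
  ultimately have le: "a * p < N" by linarith
  define B where "B = N - a * p"
  have NB: "N = a * p + B" using le unfolding B_def by simp
  have "l dvd B" using cong le unfolding B_def by (metis cong_altdef_nat cong_sym less_imp_le)
  then obtain b where b: "B = l * b" by blast
  obtain r where r: "p = r + 2" using le_Suc_ex[of 2 p] assms(4) by auto
  have "2 * l * (p - 1) = 2 * (l * r) + 2 * l" "l * p = l * r + 2 * l" 
    using r by (simp_all add: algebra_simps)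
  then have "l * r < l * b" using NB b \<open>a * p \<le> l * p\<close> assms(5) by linarith
  then have "r + 1 \<le> b" by simp
  then have "l * (r + 1) \<le> B" unfolding b by (rule mult_le_mono2)
  have B: "l * (p - 1) \<le> B" using \<open>l * (r + 1) \<le> B\<close> r by simp
  have N4: "4 * r + 4 < N" using assms(6) r by simp
  have big: "(p + l \<le> a * p + 1 \<and> p + l \<le> B + 1) \<or> N + 2 * l \<le> 2 * B + 2"
  proof (cases "a = 1")
    case True
    have "2 * p + 2 * l \<le> N + 2" 
      using N4 r assms(3) by simp
    then show ?thesis using NB True by simp
  next
    case False
    then have "2 * p \<le> a * p" using a(1) by (intro mult_le_mono1) simp
    moreover have "2 \<le> l" using a False by linarith
    then obtain m where "l = m + 2" using le_Suc_ex[of 2 l] by auto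
    moreover have "m + 3 \<le> p" using assms(3) \<open>l = m + 2\<close> by simp
    then obtain s where "p = m + s + 3" using le_Suc_ex[of "m + 3" p] by auto
    ultimately show ?thesis using B assms(3) by (simp add: algebra_simps)
  qed
  have "3 * (p + l) \<le> N + 6"
  proof (cases "l = 1")
    case True then show ?thesis using N4 r by simp
  next
    case False
    then have "2 \<le> l" using assms(2) by linarith
    then obtain m where m: "l = m + 2" using le_Suc_ex[of 2 l] by auto
    then have "m + 3 \<le> p" using assms(3) by simp
    then obtain s where s: "p = m + s + 3" using le_Suc_ex[of "m + 3" p] by auto
    show ?thesis using assms(5) unfolding m s by (simp add: algebra_simps)
  qed
  then show ?thesis using that[OF NB] big \<open>l dvd B\<close> a(1) assms(4) le unfolding B_def by auto
qed

section \<open>Arcs\<close>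

text \<open>
  Arcs are kept as sets together with their end points; the parametrization is hidden, since only
  cutting and gluing matter. An arc has two distinct end points.
\<close>

definition arc_between :: "'a topology \<Rightarrow> 'a set \<Rightarrow> 'a \<Rightarrow> 'a \<Rightarrow> bool" where
  "arc_between X A a b \<longleftrightarrow>
    (\<exists>g. continuous_map (top_of_set {0..1::real}) X g \<and> inj_on g {0..1} \<and>
         g ` {0..1} = A \<and> g 0 = a \<and> g 1 = b)"

lemma arc_between_interval:
  fixes s t :: real
  assumes "s < t" "continuous_map (top_of_set {s..t}) X g" "inj_on g {s..t}"
  shows "arc_between X (g ` {s..t}) (g s) (g t)"
proof -
  let ?u = "\<lambda>x::real. s + x * (t - s)"
  have im: "?u ` {0..1} = {s..t}"
  proof
    show "?u ` {0..1} \<subseteq> {s..t}"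
    proof
      fix y assume "y \<in> ?u ` {0..1}"
      then obtain x where x: "0 \<le> x" "x \<le> 1" "y = ?u x" by auto
      have "x * (t - s) \<le> 1 * (t - s)" using assms(1) x by (intro mult_right_mono) auto
      then have "?u x \<le> t" by (simp add: algebra_simps)
      moreover have "0 \<le> x * (t - s)" using assms(1) x by simp
      ultimately show "y \<in> {s..t}" using x(3) by simp
    qed
    show "{s..t} \<subseteq> ?u ` {0..1}"
    proof
      fix y assume "y \<in> {s..t}"
      then show "y \<in> ?u ` {0..1}"
        using assms(1) by (intro image_eqI[of _ _ "(y - s) / (t - s)"]) auto
    qed
  qed
  have "continuous_map (top_of_set {0..1}) (top_of_set {s..t}) ?u"
    using im by (auto simp: continuous_map_in_subtopology intro!: continuous_intros)
  then have "continuous_map (top_of_set {0..1}) X (g \<circ> ?u)"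
    using assms(2) continuous_map_compose by blast
  moreover have "inj_on (g \<circ> ?u) {0..1}"
    by (rule comp_inj_on) (use assms im in \<open>auto simp: inj_on_def\<close>)
  moreover have "(g \<circ> ?u) ` {0..1} = g ` {s..t}"
    unfolding image_comp[symmetric] im ..
  ultimately show ?thesis
    unfolding arc_between_def by (intro exI[of _ "g \<circ> ?u"]) auto
qed

lemma arc_between_restrict:
  assumes "continuous_map (top_of_set {0..1::real}) X g" "inj_on g {0..1}"
    and "0 \<le> s" "s < t" "t \<le> 1"
  shows "arc_between X (g ` {s..t}) (g s) (g t)"
proof (rule arc_between_interval)
  have sub: "{s..t} \<subseteq> {0..1}" using assms by auto
  show "continuous_map (top_of_set {s..t}) X g"
    by (rule continuous_map_from_subtopology_mono[OF assms(1) sub])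
  show "inj_on g {s..t}" by (rule inj_on_subset[OF assms(2) sub])
qed (rule assms(4))

lemma arc_between_sym:
  assumes "arc_between X A a b" shows "arc_between X A b a"
proof -
  obtain g where g: "continuous_map (top_of_set {0..1::real}) X g" "inj_on g {0..1}"
    "g ` {0..1} = A" "g 0 = a" "g 1 = b"
    using assms unfolding arc_between_def by blast
  let ?u = "\<lambda>x::real. 1 - x"
  have im: "?u ` {0..1} = {0..1}"
    by simp
  have "continuous_map (top_of_set {0..1}) (top_of_set {0..1}) ?u"
    by (auto simp: continuous_map_in_subtopology intro!: continuous_intros)
  then have "continuous_map (top_of_set {0..1}) X (g \<circ> ?u)"
    using g(1) continuous_map_compose by blast
  moreover have "inj_on (g \<circ> ?u) {0..1}"
    by (rule comp_inj_on) (use g im in \<open>auto simp: inj_on_def\<close>)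
  moreover have "(g \<circ> ?u) ` {0..1} = A"
    unfolding image_comp[symmetric] im by (rule g(3))
  ultimately show ?thesis
    unfolding arc_between_def using g by (intro exI[of _ "g \<circ> ?u"]) auto
qed

lemma arc_between_props:
  assumes "arc_between X A a b"
  shows "a \<in> A" "b \<in> A" "a \<noteq> b" "A \<subseteq> topspace X" "connectedin X A" "compactin X A"
proof -
  obtain g where g: "continuous_map (top_of_set {0..1::real}) X g" "inj_on g {0..1}"
    "g ` {0..1} = A" "g 0 = a" "g 1 = b"
    using assms unfolding arc_between_def by blast
  show "a \<in> A" "b \<in> A" using g by force+
  show "a \<noteq> b" using g(2,4,5) unfolding inj_on_def by force
  show "A \<subseteq> topspace X" using g(1,3) by (auto simp: continuous_map_def)
  have "connectedin (top_of_set {0..1::real}) {0..1}" "compactin (top_of_set {0..1::real}) {0..1}"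
    by (auto simp: connectedin_subtopology compactin_subtopology)
  then show "connectedin X A" "compactin X A"
    using connectedin_continuous_map_image[OF g(1)] image_compactin[OF _ g(1)] g(3) by blast+
qed

lemma arc_between_parametrized:
  assumes "arc_between X A a b" "v \<in> A"
  obtains g s where "continuous_map (top_of_set {0..1::real}) X g" "inj_on g {0..1}"
    "g ` {0..1} = A" "g 0 = a" "g 1 = b" "s \<in> {0..1}" "g s = v"
  using assms unfolding arc_between_def by (metis imageE)

lemma arc_between_split:
  assumes "arc_between X A a b" "v \<in> A" "v \<noteq> a" "v \<noteq> b"
  obtains B C where "arc_between X B a v" "arc_between X C v b" "B \<union> C = A" "B \<inter> C = {v}"
proof -
  obtain g s where g: "continuous_map (top_of_set {0..1::real}) X g" "inj_on g {0..1}"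
    "g ` {0..1} = A" "g 0 = a" "g 1 = b" "s \<in> {0..1}" "g s = v"
    using arc_between_parametrized[OF assms(1,2)] .
  have s: "0 < s" "s < 1" using g assms(3,4) by (auto simp: less_le)
  have "arc_between X (g ` {0..s}) (g 0) (g s)"
    using s by (intro arc_between_restrict g(1,2)) auto
  moreover have "arc_between X (g ` {s..1}) (g s) (g 1)"
    using s by (intro arc_between_restrict g(1,2)) auto
  moreover have "g ` {0..s} \<union> g ` {s..1} = A"
    using s g(3) by (simp add: image_Un[symmetric] ivl_disj_un)
  moreover have "g ` {0..s} \<inter> g ` {s..1} = g ` ({0..s} \<inter> {s..1})"
    by (rule inj_on_image_Int[symmetric, OF g(2)]) (use s in auto)
  moreover have "{0..s} \<inter> {s..1} = {s}" using s by auto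
  ultimately show ?thesis using that g by auto
qed

lemma arc_between_join:
  assumes "arc_between X A a b" "arc_between X B b c" "A \<inter> B = {b}"
  shows "arc_between X (A \<union> B) a c"
proof -
  obtain g where g: "continuous_map (top_of_set {0..1::real}) X g" "inj_on g {0..1}"
    "g ` {0..1} = A" "g 0 = a" "g 1 = b"
    using assms unfolding arc_between_def by blast
  obtain k where k: "continuous_map (top_of_set {0..1::real}) X k" "inj_on k {0..1}"
    "k ` {0..1} = B" "k 0 = b" "k 1 = c"
    using assms unfolding arc_between_def by blast
  let ?h = "\<lambda>x::real. if x \<le> 1 then g x else k (x - 1)"
  have im: "?h ` {0..2} = A \<union> B"
  proof
    show "?h ` {0..2} \<subseteq> A \<union> B" using g(3) k(3) by force
    have "A \<subseteq> ?h ` {0..2}"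
    proof
      fix y assume "y \<in> A"
      then obtain x where "x \<in> {0..1}" "y = g x" using g(3) by blast
      then show "y \<in> ?h ` {0..2}" by (intro image_eqI[of _ _ x]) auto
    qed
    moreover have "B \<subseteq> ?h ` {0..2}"
    proof
      fix y assume "y \<in> B"
      then obtain x where "x \<in> {0..1}" "y = k x" using k(3) by blast
      then show "y \<in> ?h ` {0..2}" using g(5) k(4)
        by (intro image_eqI[of _ _ "x + 1"]) auto
    qed
    ultimately show "A \<union> B \<subseteq> ?h ` {0..2}" by blast
  qed
  have "continuous_map (top_of_set {0..2}) X ?h"
  proof (rule continuous_map_cases_le)
    have "{x \<in> topspace (top_of_set {0..2}). x \<le> 1} = {0..1::real}" by auto
    then show "continuous_map (subtopology (top_of_set {0..2}) {x \<in> topspace (top_of_set {0..2}). x \<le> 1}) X g"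
      using g(1) by (simp add: subtopology_subtopology Int_absorb1)
    have eq: "{0..2} \<inter> {x. x \<le> 2 \<and> 0 \<le> x \<and> 1 \<le> x} = {1..2::real}" by auto
    have "continuous_map (top_of_set {1..2}) (top_of_set {0..1}) (\<lambda>x::real. x - 1)"
      by (auto simp: continuous_map_in_subtopology intro!: continuous_intros)
    then have "continuous_map (top_of_set {1..2}) X (k \<circ> (\<lambda>x. x - 1))"
      using k(1) continuous_map_compose by blast
    moreover have "{0..2} \<inter> {x \<in> topspace (top_of_set {0..2}). 1 \<le> x} = {1..2::real}" by auto
    ultimately show "continuous_map (subtopology (top_of_set {0..2}) {x \<in> topspace (top_of_set {0..2}). 1 \<le> x}) X (\<lambda>x. k (x - 1))"
      by (simp only: subtopology_subtopology o_def)
  qed (use g k in \<open>auto intro!: continuous_intros\<close>)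
  moreover have "inj_on ?h {0..2}"
  proof (rule inj_onI)
    have cross: "?h x \<noteq> ?h y" if "x \<in> {0..2}" "y \<in> {0..2}" "x \<le> 1" "1 < y" for x y :: real
    proof
      assume eq: "?h x = ?h y"
      have "g x = k (y - 1)" using eq that by simp
      moreover have "g x \<in> A" "k (y - 1) \<in> B" using g(3) k(3) that by auto
      ultimately have "k (y - 1) = k 0" using assms(3) k(4) by auto
      moreover have "y - 1 \<in> {0..1}" "0 \<in> {0..1::real}" using that by auto
      ultimately have "y - 1 = 0" using k(2) by (meson inj_onD)
      then show False using that by simp
    qed
    fix x y :: real assume xy: "x \<in> {0..2}" "y \<in> {0..2}" "?h x = ?h y"
    show "x = y"
    proof (cases "x \<le> 1"; cases "y \<le> 1")
      assume "x \<le> 1" "y \<le> 1"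
      then show ?thesis using xy inj_onD[OF g(2), of x y] by auto
    next
      assume "\<not> x \<le> 1" "\<not> y \<le> 1"
      then have "x - 1 = y - 1" using xy by (intro inj_onD[OF k(2)]) auto
      then show ?thesis by simp
    next
      assume "x \<le> 1" "\<not> y \<le> 1" then show ?thesis using cross[of x y] xy by auto
    next
      assume "\<not> x \<le> 1" "y \<le> 1" then show ?thesis using cross[of y x] xy by auto
    qed
  qed
  ultimately have "arc_between X (?h ` {0..2}) (?h 0) (?h 2)"
    by (intro arc_between_interval) auto
  then show ?thesis unfolding im using g k by simp
qed

text \<open>
  The parameters mapped into a closed set form a compact set, which has a least element: an arc can be
  cut at the first point at which it meets a closed set.
\<close>

lemma arc_between_first_hit:
  assumes A: "arc_between X A a b" and K: "closedin X K" "a \<notin> K" "A \<inter> K \<noteq> {}"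
  obtains B v where "arc_between X B a v" "B \<subseteq> A" "B \<inter> K = {v}"
proof -
  obtain g where g: "continuous_map (top_of_set {0..1::real}) X g" "inj_on g {0..1}"
    "g ` {0..1} = A" "g 0 = a" "g 1 = b"
    using A unfolding arc_between_def by blast
  define T where "T = {x \<in> {0..1}. g x \<in> K}"
  have "closedin (top_of_set {0..1}) T"
    using closedin_continuous_map_preimage[OF g(1) K(1)] unfolding T_def by simp
  then have "compact T" by (rule closedin_compact[rotated]) simp
  moreover have "T \<noteq> {}" using K(3) g(3) unfolding T_def by auto
  ultimately obtain s where s: "s \<in> T" "\<And>x. x \<in> T \<Longrightarrow> s \<le> x"
    using compact_attains_inf[of T] by metis
  have "0 \<notin> T" using K(2) g(4) unfolding T_def by blast
  then have "s \<noteq> 0" using s(1) by metis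
  moreover have "s \<in> {0..1}" using s(1) unfolding T_def by blast
  ultimately have s01: "0 < s" "s \<le> 1" by simp_all
  have "arc_between X (g ` {0..s}) (g 0) (g s)"
    using s01 by (intro arc_between_restrict g(1,2)) auto
  moreover have "g ` {0..s} \<subseteq> A" unfolding g(3)[symmetric] using s01 by (intro image_mono) auto
  moreover have "g ` {0..s} \<inter> K = {g s}"
  proof -
    have "x = s" if "x \<in> {0..s}" "g x \<in> K" for x
      using s(2)[of x] that s01 unfolding T_def by auto
    moreover have "g s \<in> K" "s \<in> {0..s}" using s(1) s01 unfolding T_def by auto
    ultimately show ?thesis by blast
  qed
  ultimately show ?thesis using that g(4) by blast
qed

lemma arc_between_subarc:
  assumes "arc_between X A a b" "v \<in> A" "w \<in> A" "v \<noteq> w"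
  obtains B where "arc_between X B v w" "B \<subseteq> A"
proof -
  obtain g s where g: "continuous_map (top_of_set {0..1::real}) X g" "inj_on g {0..1}"
    "g ` {0..1} = A" "g 0 = a" "g 1 = b" "s \<in> {0..1}" "g s = v"
    using arc_between_parametrized[OF assms(1,2)] .
  obtain t where t: "t \<in> {0..1}" "g t = w" using assms(3) g(3) by blast
  have sub: "arc_between X (g ` {x..y}) (g x) (g y)" "g ` {x..y} \<subseteq> A"
    if "x < y" "x \<in> {0..1}" "y \<in> {0..1}" for x y
  proof -
    show "arc_between X (g ` {x..y}) (g x) (g y)"
      using that by (intro arc_between_restrict g(1,2)) auto
    show "g ` {x..y} \<subseteq> A" unfolding g(3)[symmetric] using that by (intro image_mono) auto
  qed
  consider "s < t" | "t < s" using assms(4) g(7) t(2) by (metis linorder_neqE_linordered_idom)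
  then show ?thesis
  proof cases
    case 1 then show ?thesis using sub[of s t] that g t by blast
  next
    case 2 then show ?thesis using sub[of t s] that g t arc_between_sym by metis
  qed
qed

text \<open>
  Two consecutive arcs may cross. Walking along the first one only until it meets the second one, and
  then switching, gives an arc.
\<close>

lemma arc_between_trans:
  assumes "Hausdorff_space X" "arc_between X A a b" "arc_between X B b c" "a \<noteq> c"
  obtains C where "arc_between X C a c" "C \<subseteq> A \<union> B"
proof (cases "a \<in> B")
  case True
  then show ?thesis
    using arc_between_subarc[OF assms(3) True arc_between_props(2)[OF assms(3)] assms(4)] that
    by (metis le_supI2)
next
  case False
  have "closedin X B" using arc_between_props(6)[OF assms(3)] assms(1) by (rule compactin_imp_closedin[rotated])
  moreover have "A \<inter> B \<noteq> {}" using arc_between_props[OF assms(2)] arc_between_props[OF assms(3)] by blast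
  ultimately obtain A' v where A': "arc_between X A' a v" "A' \<subseteq> A" "A' \<inter> B = {v}"
    using arc_between_first_hit[OF assms(2)] False by metis
  show ?thesis
  proof (cases "v = c")
    case True then show ?thesis using A' that by blast
  next
    case False
    obtain B' where B': "arc_between X B' v c" "B' \<subseteq> B"
      using arc_between_subarc[OF assms(3) _ arc_between_props(2)[OF assms(3)] False] A'(3) by blast
    have "A' \<inter> B' = {v}" using A' B' arc_between_props(1)[OF B'(1)] by blast
    then show ?thesis using arc_between_join[OF A'(1) B'(1)] that A' B' by blast
  qed
qed

text \<open>
  The upper half circle is mapped along one arc, the lower half circle along the other one, both by the
  real part. A continuous injection of a compact space into a Hausdorff space is an embedding.
\<close>

lemma two_arcs_form_circle:
  assumes "Hausdorff_space X" "arc_between X A a b" "arc_between X B a b" "A \<inter> B = {a, b}"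
  shows "\<exists>S \<subseteq> topspace X. subtopology X S homeomorphic_space top_of_set (sphere (0::complex) 1)"
proof -
  obtain g where g: "continuous_map (top_of_set {0..1::real}) X g" "inj_on g {0..1}"
    "g ` {0..1} = A" "g 0 = a" "g 1 = b"
    using assms unfolding arc_between_def by blast
  obtain k where k: "continuous_map (top_of_set {0..1::real}) X k" "inj_on k {0..1}"
    "k ` {0..1} = B" "k 0 = a" "k 1 = b"
    using assms unfolding arc_between_def by blast
  let ?T = "top_of_set (sphere (0::complex) 1)"
  let ?u = "\<lambda>z. (1 - Re z) / 2"
  let ?h = "\<lambda>z. if 0 \<le> Im z then g (?u z) else k (?u z)"
  have u01: "?u z \<in> {0..1}" if "cmod z = 1" for z
    using that abs_Re_le_cmod[of z] by auto
  have sph: "Re z = Re w" "(Im z)\<^sup>2 = (Im w)\<^sup>2" if "cmod z = 1" "cmod w = 1" "?u z = ?u w" for z w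
    using that cmod_power2[of z] cmod_power2[of w] by auto
  have ends: "?u z = 0 \<or> ?u z = 1" if "cmod z = 1" "Im z = 0" for z
  proof -
    have "(Re z)\<^sup>2 = 1" using that cmod_power2[of z] by simp
    then show ?thesis by (auto simp: power2_eq_1_iff)
  qed
  have cu: "continuous_map ?T (top_of_set {0..1}) ?u"
    using u01 by (auto simp: continuous_map_in_subtopology intro!: continuous_intros)
  have cont: "continuous_map ?T X ?h"
  proof (rule continuous_map_cases_le)
    show "continuous_map (subtopology ?T {x \<in> topspace ?T. 0 \<le> Im x}) X (\<lambda>z. g (?u z))"
      using continuous_map_from_subtopology[OF continuous_map_compose[OF cu g(1)]] by (simp only: o_def)
    show "continuous_map (subtopology ?T {x \<in> topspace ?T. Im x \<le> 0}) X (\<lambda>z. k (?u z))"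
      using continuous_map_from_subtopology[OF continuous_map_compose[OF cu k(1)]] by (simp only: o_def)
    show "g (?u z) = k (?u z)" if "z \<in> topspace ?T" "0 = Im z" for z
      using ends[of z] that g k by auto
  qed (auto intro!: continuous_intros)
  have inj: "inj_on ?h (topspace ?T)"
  proof (rule inj_onI)
    have cross: False if "cmod z = 1" "cmod w = 1" "0 \<le> Im z" "Im w < 0" "g (?u z) = k (?u w)" for z w
    proof -
      have "g (?u z) \<in> A" "k (?u w) \<in> B" using u01 that g(3) k(3) by blast+
      then have "k (?u w) \<in> {k 0, k 1}" using assms(4) that(5) k by auto
      then have "?u w = 0 \<or> ?u w = 1"
        using inj_onD[OF k(2), of "?u w" 0] inj_onD[OF k(2), of "?u w" 1] u01[OF that(2)] by auto
      then have "(Re w)\<^sup>2 = 1" by (auto simp: power2_eq_1_iff)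
      then have "Im w = 0" using that(2) cmod_power2[of w] by simp
      then show False using that by simp
    qed
    fix z w assume "z \<in> topspace ?T" "w \<in> topspace ?T" and eq: "?h z = ?h w"
    then have zw: "cmod z = 1" "cmod w = 1" by auto
    have same: "z = w" if "?u z = ?u w" "(0 \<le> Im z) = (0 \<le> Im w)"
    proof -
      have "\<bar>Im z\<bar> = \<bar>Im w\<bar>" using sph(2)[OF zw that(1)] by (simp add: power2_eq_iff abs_eq_iff)
      then show ?thesis using sph(1)[OF zw that(1)] that(2) by (intro complex_eqI) (auto split: if_splits)
    qed
    show "z = w"
    proof (cases "0 \<le> Im z"; cases "0 \<le> Im w")
      assume "0 \<le> Im z" "0 \<le> Im w"
      then show ?thesis using eq same inj_onD[OF g(2), of "?u z" "?u w"] u01 zw by auto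
    next
      assume "\<not> 0 \<le> Im z" "\<not> 0 \<le> Im w"
      then show ?thesis using eq same inj_onD[OF k(2), of "?u z" "?u w"] u01 zw by auto
    next
      assume "0 \<le> Im z" "\<not> 0 \<le> Im w"
      then show ?thesis using eq cross[OF zw] by auto
    next
      assume "\<not> 0 \<le> Im z" "0 \<le> Im w"
      then show ?thesis using eq cross[OF zw(2) zw(1)] by auto
    qed
  qed
  let ?S = "?h ` topspace ?T"
  have sub: "?S \<subseteq> topspace X" by (rule continuous_map_image_subset_topspace[OF cont])
  have "homeomorphic_map ?T (subtopology X ?S) ?h"
  proof (rule continuous_imp_homeomorphic_map)
    show "compact_space ?T" by (simp add: compact_space_subtopology compactin_euclidean_iff)
    show "Hausdorff_space (subtopology X ?S)" using assms(1) by (rule Hausdorff_space_subtopology)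
    show "continuous_map ?T (subtopology X ?S) ?h"
      using cont by (auto simp: continuous_map_in_subtopology)
    show "?h ` topspace ?T = topspace (subtopology X ?S)" using sub by (auto simp: topspace_subtopology)
    show "inj_on ?h (topspace ?T)" by (rule inj)
  qed
  then have "?T homeomorphic_space subtopology X ?S"
    by (rule homeomorphic_map_imp_homeomorphic_space)
  then show ?thesis using sub homeomorphic_space_sym by blast
qed

section \<open>Segments and star charts\<close>

text \<open>
  The segment from \<open>a\<close> to \<open>b\<close>, defined by separation instead of by paths: a point \<open>v\<close> different from \<open>a\<close>
  and \<open>b\<close> belongs to it if and only if \<open>a\<close> and \<open>b\<close> lie in different components of the complement of \<open>v\<close>.
  In a tree it is the arc from \<open>a\<close> to \<open>b\<close>.
\<close>

definition seg :: "'a topology \<Rightarrow> 'a \<Rightarrow> 'a \<Rightarrow> 'a set" where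
  "seg X a b = {v \<in> topspace X. \<forall>C. connectedin X C \<and> a \<in> C \<and> b \<in> C \<longrightarrow> v \<in> C}"

lemma seg_subset_connectedin:
  "connectedin X C \<Longrightarrow> a \<in> C \<Longrightarrow> b \<in> C \<Longrightarrow> seg X a b \<subseteq> C"
  unfolding seg_def by blast

lemma seg_singleton: "a \<in> topspace X \<Longrightarrow> seg X a a = {a}"
  using seg_subset_connectedin[of X "{a}" a a] unfolding seg_def by auto

lemma seg_commute: "seg X a b = seg X b a"
  unfolding seg_def by blast

lemma star_point_in:
  "0 \<le> t \<Longrightarrow> t < 1 \<Longrightarrow> j < n \<Longrightarrow> of_real t * cis (2 * pi * real j / real n) \<in> open_star n"
  unfolding open_star_def by blast

text \<open>
  The inverse \<open>k\<close> of a star chart \<open>g\<close>, and a radius \<open>e\<close> so small that the open star of that radius is mapped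
  into a prescribed neighbourhood \<open>W\<close> of the centre.
\<close>

lemma chart_ball:
  assumes "openin X W" "x \<in> W" "openin X U" "x \<in> U"
    "homeomorphic_map (subtopology X U) (top_of_set (open_star n)) g" "g x = 0"
  obtains k e where "continuous_map (top_of_set (open_star n)) X k" "inj_on k (open_star n)" "k 0 = x"
    "k ` open_star n = U" "\<forall>z\<in>open_star n. g (k z) = z" "\<forall>y\<in>U. k (g y) = y"
    "0 < e" "e < 1" "\<forall>z\<in>open_star n. cmod z < e \<longrightarrow> k z \<in> W"
    "openin X (k ` (open_star n \<inter> ball 0 e))"
proof -
  have Usub: "U \<subseteq> topspace X" using assms(3) by (rule openin_subset)
  obtain k where k: "homeomorphic_maps (subtopology X U) (top_of_set (open_star n)) g k"
    using assms(5) unfolding homeomorphic_map_maps by blast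
  have kc: "continuous_map (top_of_set (open_star n)) (subtopology X U) k"
    and kg: "\<And>y. y \<in> U \<Longrightarrow> k (g y) = y" and gk: "\<And>z. z \<in> open_star n \<Longrightarrow> g (k z) = z"
    and gc: "continuous_map (subtopology X U) (top_of_set (open_star n)) g"
    using k Usub unfolding homeomorphic_maps_def by (auto simp: topspace_subtopology)
  have kim: "k z \<in> U" if "z \<in> open_star n" for z
    using kc that by (auto simp: continuous_map_in_subtopology)
  have gim: "g y \<in> open_star n" if "y \<in> U" for y
    using gc that Usub by (auto simp: continuous_map_in_subtopology topspace_subtopology)
  have zin: "0 \<in> open_star n" using gim[OF assms(4)] assms(6) by simp
  have k0: "k 0 = x" using kg[OF assms(4)] assms(6) by simp
  have c: "continuous_map (top_of_set (open_star n)) X k"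
    using kc by (simp add: continuous_map_in_subtopology)
  have "openin (top_of_set (open_star n)) {z \<in> topspace (top_of_set (open_star n)). k z \<in> W}"
    using openin_continuous_map_preimage[OF c assms(1)] .
  then obtain T where T: "open T" "{z \<in> open_star n. k z \<in> W} = open_star n \<inter> T"
    by (auto simp: openin_open)
  have "0 \<in> T" using T(2) zin k0 assms(2) by auto
  then obtain e where e: "0 < e" "ball 0 e \<subseteq> T" using T(1) open_contains_ball by blast
  let ?e = "min e (1/2)"
  have "openin (subtopology X U) {y \<in> topspace (subtopology X U). g y \<in> open_star n \<inter> ball 0 ?e}"
    by (rule openin_continuous_map_preimage[OF gc]) (auto simp: openin_open)
  moreover have "{y \<in> topspace (subtopology X U). g y \<in> open_star n \<inter> ball 0 ?e} = k ` (open_star n \<inter> ball 0 ?e)"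
    (is "?L = ?R")
  proof
    show "?L \<subseteq> ?R" using kg Usub by (force simp: topspace_subtopology)
    show "?R \<subseteq> ?L" using gk kim Usub by (auto simp: topspace_subtopology)
  qed
  ultimately have "openin X (k ` (open_star n \<inter> ball 0 ?e))"
    using openin_trans_full[OF _ assms(3)] by metis
  moreover have "k z \<in> W" if "z \<in> open_star n" "cmod z < ?e" for z
  proof -
    have "z \<in> open_star n \<inter> T" using e that by auto
    then show ?thesis using T(2) by blast
  qed
  moreover have "inj_on k (open_star n)" using gk by (metis inj_on_def)
  moreover have "k ` open_star n = U" using kim kg gim by (auto intro!: image_eqI)
  ultimately show ?thesis using that[of k ?e] c k0 e gk kg by auto
qed

text \<open>
  The rays of a chart join its centre to all nearby points. As every point of a graph is the centre of a
  chart, this is all that is needed for local arcwise connectedness.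
\<close>

lemma local_radial_arcs:
  assumes "\<exists>n. has_valence X x n" "openin X W" "x \<in> W"
  obtains V where "openin X V" "x \<in> V" "V \<subseteq> W"
    "\<And>y. y \<in> V \<Longrightarrow> y \<noteq> x \<Longrightarrow> \<exists>A\<subseteq>V. arc_between X A x y"
proof -
  obtain n U g where ch: "openin X U" "x \<in> U"
    "homeomorphic_map (subtopology X U) (top_of_set (open_star n)) g" "g x = 0"
    using assms(1) unfolding has_valence_def by blast
  obtain k e where kk: "continuous_map (top_of_set (open_star n)) X k" "inj_on k (open_star n)" "k 0 = x"
    "k ` open_star n = U" "\<forall>z\<in>open_star n. g (k z) = z" "\<forall>y\<in>U. k (g y) = y"
    "0 < e" "e < 1" "\<forall>z\<in>open_star n. cmod z < e \<longrightarrow> k z \<in> W"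
    "openin X (k ` (open_star n \<inter> ball 0 e))"
    using chart_ball[OF assms(2,3) ch(1,2,3) ch(4)] .
  note k = kk(1-3) and e = kk(7,8) and W = kk(9) and op = kk(10) and U = kk(4) ch(4) kk(6,5)
  let ?V = "k ` (open_star n \<inter> ball 0 e)"
  have "0 \<in> open_star n" using U ch(2) by (metis imageE)
  then have "x \<in> ?V" using k(3) e by force
  moreover have "?V \<subseteq> W" using W by auto
  moreover have "\<exists>A\<subseteq>?V. arc_between X A x y" if y: "y \<in> ?V" "y \<noteq> x" for y
  proof -
    obtain z where z: "z \<in> open_star n" "cmod z < e" "y = k z" using y(1) by auto
    then obtain t j where t: "z = of_real t * cis (2 * pi * real j / real n)" "0 \<le> t" "t < 1" "j < n"
      unfolding open_star_def by blast
    let ?c = "cis (2 * pi * real j / real n)"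
    have te: "t < e" using z(2) t by (simp add: norm_mult)
    have "t \<noteq> 0" using y(2) z(3) t k(3) by auto
    then have t0: "0 < t" using t by simp
    have ray: "of_real s * ?c \<in> open_star n \<inter> ball 0 e" if "s \<in> {0..t}" for s
      using that te t e by (auto simp: norm_mult intro!: star_point_in)
    have "continuous_map (top_of_set {0..t}) (top_of_set (open_star n)) (\<lambda>s. of_real s * ?c)"
      using ray by (auto simp: continuous_map_in_subtopology intro!: continuous_intros)
    then have "continuous_map (top_of_set {0..t}) X (k \<circ> (\<lambda>s. of_real s * ?c))"
      using k(1) continuous_map_compose by blast
    moreover have "inj_on (k \<circ> (\<lambda>s. of_real s * ?c)) {0..t}"
    proof (rule comp_inj_on)
      show "inj_on (\<lambda>s. of_real s * ?c) {0..t}" by (auto simp: inj_on_def)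
      show "inj_on k ((\<lambda>s. of_real s * ?c) ` {0..t})" 
        by (rule inj_on_subset[OF k(2)]) (use ray in blast)
    qed
    ultimately have "arc_between X ((k \<circ> (\<lambda>s. of_real s * ?c)) ` {0..t})
        ((k \<circ> (\<lambda>s. of_real s * ?c)) 0) ((k \<circ> (\<lambda>s. of_real s * ?c)) t)"
      by (intro arc_between_interval t0)
    moreover have "(k \<circ> (\<lambda>s. of_real s * ?c)) ` {0..t} \<subseteq> ?V" using ray by auto
    ultimately show ?thesis using k(3) z(3) t(1) by auto
  qed
  ultimately show ?thesis using that op by blast
qed

lemma star_cis_inject:
  assumes "j < n" "j' < n" "cis (2 * pi * real j / real n) = cis (2 * pi * real j' / real n)"
  shows "j = j'"
proof -
  have n: "0 < n" using assms by simp
  have "cis (2 * pi * real j / real n) = exp (2 * of_real pi * \<i> * of_nat j / of_nat n)" for j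
    by (simp add: cis_conv_exp mult_ac)
  then have "exp (2 * of_real pi * \<i> * of_nat j / of_nat n) = exp (2 * of_real pi * \<i> * of_nat j' / of_nat n)"
    using assms(3) by metis
  then have "[j = j'] (mod n)" using complex_root_unity_eq[of n j j'] n by (simp add: cong_def)
  then show ?thesis using assms(1,2) by (simp add: cong_def)
qed

text \<open>
  Two rays of a star with at least two branches form an arc through its centre.
\<close>

lemma arc_through_centre:
  assumes "has_valence X x n" "n \<noteq> 1"
  shows "\<exists>A a b. arc_between X A a b \<and> x \<in> A \<and> x \<noteq> a \<and> x \<noteq> b"
proof -
  have n: "2 \<le> n" using assms unfolding has_valence_def by auto
  obtain U g where ch: "openin X U" "x \<in> U"
    "homeomorphic_map (subtopology X U) (top_of_set (open_star n)) g" "g x = 0"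
    using assms(1) unfolding has_valence_def by blast
  obtain k e where k: "continuous_map (top_of_set (open_star n)) X k" "inj_on k (open_star n)" "k 0 = x"
    "k ` open_star n = U" "\<forall>z\<in>open_star n. g (k z) = z" "\<forall>y\<in>U. k (g y) = y"
    "0 < e" "e < 1" "\<forall>z\<in>open_star n. cmod z < e \<longrightarrow> k z \<in> U"
    "openin X (k ` (open_star n \<inter> ball 0 e))"
    using chart_ball[OF ch(1,2) ch(1,2,3,4)] .
  let ?c = "cis (2 * pi * real 1 / real n)"
  let ?r = "\<lambda>s::real. if s \<le> 0 then of_real (-s) * cis (2 * pi * real 0 / real n) else of_real s * ?c"
  let ?I = "{-1/2..1/2::real}"
  have c1: "?c \<noteq> 1" using star_cis_inject[of 1 n 0] n by auto
  have ray: "?r s \<in> open_star n" if "s \<in> ?I" for s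
    using that n star_point_in[of "-s" 0 n] star_point_in[of s 1 n] by auto
  have "continuous_on ?I ?r"
    by (rule continuous_on_cases_le) (auto intro!: continuous_intros)
  then have "continuous_map (top_of_set ?I) (top_of_set (open_star n)) ?r"
    using ray by (auto simp: continuous_map_in_subtopology)
  then have "continuous_map (top_of_set ?I) X (k \<circ> ?r)"
    using k(1) continuous_map_compose by blast
  moreover have "inj_on (k \<circ> ?r) ?I"
  proof (rule comp_inj_on)
    have cross: False if "s \<le> 0" "0 < t" "of_real (-s) = of_real t * ?c" for s t :: real
    proof -
      have "cmod (of_real (-s)) = cmod (of_real t * ?c)" using that(3) by simp
      then have "-s = t" using that by (simp add: norm_mult)
      then show False using that c1 by simp
    qed
    show "inj_on ?r ?I"
    proof (rule inj_onI)
      fix s t assume st: "s \<in> ?I" "t \<in> ?I" "?r s = ?r t"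
      show "s = t"
        using st(3) cross[of s t] cross[of t s] by (cases "s \<le> 0"; cases "t \<le> 0") auto
    qed
    show "inj_on k (?r ` ?I)" by (rule inj_on_subset[OF k(2)]) (use ray in blast)
  qed
  ultimately have arc: "arc_between X ((k \<circ> ?r) ` ?I) ((k \<circ> ?r) (-1/2)) ((k \<circ> ?r) (1/2))"
    by (intro arc_between_interval) auto
  obtain h where h: "h = k \<circ> ?r" by blast
  have hi: "inj_on h ?I" unfolding h by fact
  have "h 0 = x" using k(3) by (simp add: h)
  moreover have "h 0 \<noteq> h (-1/2)" "h 0 \<noteq> h (1/2)"
    by (rule inj_on_contraD[OF hi]; simp)+
  moreover have "h 0 \<in> h ` ?I" by (rule imageI) simp
  ultimately show ?thesis using arc[folded h] by blast
qed

text \<open>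
  A point of a chart other than the centre is interior to a ray. The arc around it can be taken inside any
  of its neighbourhoods \<open>V\<close>, which will be compared with a second chart.
\<close>

lemma arc_through_branch_point:
  assumes "openin X U" "homeomorphic_map (subtopology X U) (top_of_set (open_star n)) g"
    "x \<in> U" "g x = 0" "y \<in> U" "y \<noteq> x" "openin X V" "y \<in> V"
  shows "\<exists>A a b. arc_between X A a b \<and> A \<subseteq> V \<and> y \<in> A \<and> y \<noteq> a \<and> y \<noteq> b"
proof -
  obtain k e where k: "continuous_map (top_of_set (open_star n)) X k" "inj_on k (open_star n)" "k 0 = x"
    "k ` open_star n = U" "\<forall>z\<in>open_star n. g (k z) = z" "\<forall>y\<in>U. k (g y) = y"
    "0 < e" "e < 1" "\<forall>z\<in>open_star n. cmod z < e \<longrightarrow> k z \<in> U"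
    "openin X (k ` (open_star n \<inter> ball 0 e))"
    using chart_ball[OF assms(1,3) assms(1,3,2,4)] .
  obtain t j where t: "y = k (of_real t * cis (2 * pi * real j / real n))" "0 \<le> t" "t < 1" "j < n"
    using assms(5) unfolding k(4)[symmetric] open_star_def by blast
  let ?c = "cis (2 * pi * real j / real n)"
  let ?h = "\<lambda>s. k (of_real s * ?c)"
  have "t \<noteq> 0" using t(1) k(3) assms(6) by auto
  then have t0: "0 < t" using t by simp
  have ray: "of_real s * ?c \<in> open_star n" if "s \<in> {0..<1}" for s
    using that t star_point_in by auto
  have "continuous_map (top_of_set {0..<1}) (top_of_set (open_star n)) (\<lambda>s. of_real s * ?c)"
    using ray by (auto simp: continuous_map_in_subtopology intro!: continuous_intros)
  then have hc: "continuous_map (top_of_set {0..<1}) X ?h"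
    using continuous_map_compose[OF _ k(1)] by (simp only: o_def)
  have "inj_on (k \<circ> (\<lambda>s. of_real s * ?c)) {0..<1}"
  proof (rule comp_inj_on)
    show "inj_on (\<lambda>s. of_real s * ?c) {0..<1}" by (auto simp: inj_on_def)
    show "inj_on k ((\<lambda>s. of_real s * ?c) ` {0..<1})" 
      by (rule inj_on_subset[OF k(2)]) (use ray in blast)
  qed
  then have hi: "inj_on ?h {0..<1}" by (simp add: o_def)
  have "openin (top_of_set {0..<1}) {s \<in> topspace (top_of_set {0..<1}). ?h s \<in> V}"
    by (rule openin_continuous_map_preimage[OF hc assms(7)])
  then obtain T where T: "open T" "{s \<in> {0..<1}. ?h s \<in> V} = {0..<1} \<inter> T"
    by (auto simp: openin_open)
  have "t \<in> {s \<in> {0..<1}. ?h s \<in> V}" using t assms(8) by simp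
  then have "t \<in> T" unfolding T(2) by blast
  then obtain d where d: "0 < d" "cball t d \<subseteq> T" using T(1) open_contains_cball by blast
  obtain e where e: "0 < e" "e \<le> d" "e < t" "e < 1 - t"
    using that[of "min d (min (t/2) ((1-t)/2))"] d(1) t0 t(3) by (auto simp: min_def)
  have sub: "{t - e..t + e} \<subseteq> {0..<1} \<inter> T"
  proof
    fix s assume s: "s \<in> {t - e..t + e}"
    then have "\<bar>t - s\<bar> \<le> d" using e(2) by (simp add: abs_le_iff)
    then have "s \<in> cball t d" by (simp add: dist_real_def)
    then show "s \<in> {0..<1} \<inter> T" using d(2) s e by auto
  qed
  obtain h where h: "h = ?h" by blast
  have "arc_between X (h ` {t - e..t + e}) (h (t - e)) (h (t + e))"
  proof (rule arc_between_interval)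
    show "continuous_map (top_of_set {t - e..t + e}) X h"
      unfolding h using sub by (intro continuous_map_from_subtopology_mono[OF hc]) blast
    show "inj_on h {t - e..t + e}" unfolding h by (rule inj_on_subset[OF hi]) (use sub in blast)
  qed (use e in simp)
  moreover have "h ` {t - e..t + e} \<subseteq> V" using sub T(2) h by blast
  moreover have "h t \<noteq> h (t - e)" "h t \<noteq> h (t + e)"
    by (rule inj_on_contraD[OF hi[folded h]]; use e t0 t in simp)+
  moreover have "h t \<in> h ` {t - e..t + e}" using e by (intro imageI) auto
  moreover have "y = h t" using t(1) h by simp
  ultimately show ?thesis by blast
qed

section \<open>Segments in a tree are arcs\<close>

text \<open>
  The points of \<open>W\<close> that can be reached from \<open>a\<close> by an arc in \<open>W\<close> form an open set with open complement
  in \<open>W\<close>; the connected set \<open>C\<close> cannot meet both.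
\<close>

lemma arc_in_open_set:
  assumes haus: "Hausdorff_space X" and val: "\<forall>x \<in> topspace X. \<exists>n. has_valence X x n"
    and W: "openin X W" and C: "connectedin X C" "C \<subseteq> W" "a \<in> C" "b \<in> C" "a \<noteq> b"
  shows "\<exists>A\<subseteq>W. arc_between X A a b"
proof -
  have WX: "W \<subseteq> topspace X" using W by (rule openin_subset)
  define R where "R = {y \<in> W. y = a \<or> (\<exists>A\<subseteq>W. arc_between X A a y)}"
  have move: "z \<in> R" if y: "y \<in> R" "arc_between X B y z" "B \<subseteq> W" for y z B
  proof (cases "z = a")
    case True
    then show ?thesis using C unfolding R_def by blast
  next
    case za: False
    have "z \<in> W" using arc_between_props(2)[OF y(2)] y(3) by blast
    moreover have "\<exists>A\<subseteq>W. arc_between X A a z"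
    proof (cases "y = a")
      case True then show ?thesis using y by blast
    next
      case False
      then obtain A where A: "A \<subseteq> W" "arc_between X A a y" using y(1) unfolding R_def by blast
      obtain D where "arc_between X D a z" "D \<subseteq> A \<union> B"
        using arc_between_trans[OF haus A(2) y(2)] za by blast
      then show ?thesis using A(1) y(3) by blast
    qed
    ultimately show ?thesis unfolding R_def by blast
  qed
  have nbhd: "\<exists>V. openin X V \<and> y \<in> V \<and> V \<subseteq> W \<and> (\<forall>z\<in>V. z \<in> R \<longleftrightarrow> y \<in> R)" if y: "y \<in> W" for y
  proof -
    have "\<exists>n. has_valence X y n" using val y WX by blast
    then obtain V where V: "openin X V" "y \<in> V" "V \<subseteq> W"
        "\<And>z. z \<in> V \<Longrightarrow> z \<noteq> y \<Longrightarrow> \<exists>A\<subseteq>V. arc_between X A y z"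
      using local_radial_arcs[OF _ W y] by metis
    have "z \<in> R \<longleftrightarrow> y \<in> R" if z: "z \<in> V" for z
    proof (cases "z = y")
      case False
      then obtain A where A: "A \<subseteq> V" "arc_between X A y z" using V(4) z by blast
      then have "A \<subseteq> W" using V(3) by blast
      then show ?thesis using move[OF _ A(2)] move[OF _ arc_between_sym[OF A(2)]] by blast
    qed simp
    then show ?thesis using V by blast
  qed
  have "openin X R" 
  proof (subst openin_subopen, intro ballI)
    fix y assume y: "y \<in> R"
    then have "y \<in> W" unfolding R_def by blast
    from nbhd[OF this] obtain V where "openin X V" "y \<in> V" "\<forall>z\<in>V. z \<in> R \<longleftrightarrow> y \<in> R" by metis
    then show "\<exists>T. openin X T \<and> y \<in> T \<and> T \<subseteq> R" using y by (intro exI[of _ V]) blast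
  qed
  moreover have "openin X (W - R)"
  proof (subst openin_subopen, intro ballI)
    fix y assume y: "y \<in> W - R"
    then have "y \<in> W" by blast
    from nbhd[OF this] obtain V where "openin X V" "y \<in> V" "V \<subseteq> W" "\<forall>z\<in>V. z \<in> R \<longleftrightarrow> y \<in> R" by metis
    then show "\<exists>T. openin X T \<and> y \<in> T \<and> T \<subseteq> W - R" using y by (intro exI[of _ V]) blast
  qed
  moreover have "C \<subseteq> R \<union> (W - R)" "R \<inter> (W - R) \<inter> C = {}" using C(2) by auto
  moreover have "a \<in> R" using C unfolding R_def by blast
  ultimately have "(W - R) \<inter> C = {}"
    using C(1,3) unfolding connectedin by blast
  then have "b \<in> R" using C by blast
  then show ?thesis using C(5) unfolding R_def by blast
qed

text \<open>
  A point \<open>v\<close> of one arc off the other one lies on a piece of the first arc that meets the second arc in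
  its two end points only. Together with the part of the second arc between these it forms a circle.
\<close>

lemma arc_unique_without_circle:
  assumes haus: "Hausdorff_space X"
    and circ: "\<not> (\<exists>S \<subseteq> topspace X. subtopology X S homeomorphic_space top_of_set (sphere (0::complex) 1))"
    and J: "arc_between X J a b" and K: "arc_between X K a b"
  shows "J \<subseteq> K"
proof
  fix v assume v: "v \<in> J"
  show "v \<in> K"
  proof (rule ccontr)
    assume vK: "v \<notin> K"
    then have "v \<noteq> a" "v \<noteq> b" using arc_between_props[OF K] by blast+
    then obtain J1 J2 where J1: "arc_between X J1 a v" and J2: "arc_between X J2 v b" 
      and JJ: "J1 \<inter> J2 = {v}"
      using arc_between_split[OF J v] by metis
    have clK: "closedin X K" using arc_between_props(6)[OF K] haus by (rule compactin_imp_closedin[rotated])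
    \<comment> \<open>leave \<open>v\<close> along \<open>J\<close> in both directions until \<open>K\<close> is reached\<close>
    have "J1 \<inter> K \<noteq> {}" "J2 \<inter> K \<noteq> {}"
      using arc_between_props[OF J1] arc_between_props[OF J2] arc_between_props[OF K] by blast+
    note meets = this
    obtain B1 s1 where B1: "arc_between X B1 v s1" "B1 \<subseteq> J1" "B1 \<inter> K = {s1}"
      by (rule arc_between_first_hit[OF arc_between_sym[OF J1] clK vK meets(1)])
    obtain B2 s2 where B2: "arc_between X B2 v s2" "B2 \<subseteq> J2" "B2 \<inter> K = {s2}"
      by (rule arc_between_first_hit[OF J2 clK vK meets(2)])
    have "B1 \<inter> B2 = {v}" using B1 B2 JJ arc_between_props(1)[OF B1(1)] arc_between_props(1)[OF B2(1)] by blast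
    then have L: "arc_between X (B1 \<union> B2) s1 s2"
      using arc_between_join[OF arc_between_sym[OF B1(1)] B2(1)] by simp
    then have s12: "s1 \<noteq> s2" by (rule arc_between_props(3))
    obtain K' where K': "arc_between X K' s1 s2" "K' \<subseteq> K"
      using arc_between_subarc[OF K _ _ s12] B1(3) B2(3) by blast
    have "(B1 \<union> B2) \<inter> K' = {s1, s2}"
      using B1(3) B2(3) K' arc_between_props(1,2)[OF K'(1)] by blast
    then show False using two_arcs_form_circle[OF haus L K'(1)] circ by blast
  qed
qed

text \<open>
  If a connected set joined the end points of an arc \<open>A\<close> while missing a point \<open>v\<close> of \<open>A\<close>, then so would
  an arc in the complement of \<open>v\<close>, against the uniqueness of arcs.
\<close>

lemma tree_seg_eq_arc:
  assumes tree: "topological_tree X" and A: "arc_between X A a b"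
  shows "seg X a b = A"
proof
  have haus: "Hausdorff_space X" and val: "\<forall>x \<in> topspace X. \<exists>n. has_valence X x n"
    and circ: "\<not> (\<exists>S \<subseteq> topspace X. subtopology X S homeomorphic_space top_of_set (sphere (0::complex) 1))"
    using tree unfolding topological_tree_def topological_graph_def by blast+
  show "seg X a b \<subseteq> A"
    using arc_between_props[OF A] by (intro seg_subset_connectedin)
  have all: "v \<in> C" if v: "v \<in> A" and C: "connectedin X C" "a \<in> C" "b \<in> C" for v C
  proof (rule ccontr)
    assume "v \<notin> C"
    moreover have "C \<subseteq> topspace X" using C(1) by (simp add: connectedin_def)
    ultimately have "C \<subseteq> topspace X - {v}" by blast
    moreover have "v \<in> topspace X" using v arc_between_props(4)[OF A] by blast
    then have "openin X (topspace X - {v})" using closedin_Hausdorff_singleton[OF haus] by blast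
    ultimately obtain K where "K \<subseteq> topspace X - {v}" "arc_between X K a b"
      using arc_in_open_set[OF haus val _ C(1) _ C(2,3) arc_between_props(3)[OF A]] by blast
    then show False using arc_unique_without_circle[OF haus circ A] v by blast
  qed
  show "A \<subseteq> seg X a b"
  proof
    fix v assume "v \<in> A"
    then show "v \<in> seg X a b"
      unfolding seg_def using all arc_between_props(4)[OF A] by (intro CollectI conjI allI impI) auto
  qed
qed

lemma tree_arc_exists:
  assumes tree: "topological_tree X" and "a \<in> topspace X" "b \<in> topspace X" "a \<noteq> b"
  shows "\<exists>A. arc_between X A a b"
proof -
  have conn: "connectedin X (topspace X)"
    using tree unfolding topological_tree_def by (simp add: connectedin_topspace)
  have hv: "Hausdorff_space X" "\<forall>x \<in> topspace X. \<exists>n. has_valence X x n"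
    using tree unfolding topological_tree_def topological_graph_def by blast+
  show ?thesis
    using arc_in_open_set[OF hv openin_topspace conn order_refl assms(2,3,4)] by metis
qed

text \<open>
  The properties of a tree on which the dynamical part of the proof rests. All of them speak about segments
  only, and neither charts nor arcs occur any more. For a fixed root \<open>h\<close> the relation \<open>x \<in> seg X h y\<close> is
  read as \<open>x \<le> y\<close>: it is a tree order with least element \<open>h\<close>.
\<close>

locale dendrite =
  fixes X :: "'a topology"
  assumes compact: "compact_space X" and Hausdorff: "Hausdorff_space X"
    and connectedin_seg: "\<lbrakk>a \<in> topspace X; b \<in> topspace X\<rbrakk> \<Longrightarrow> connectedin X (seg X a b)"
    and closedin_seg: "\<lbrakk>a \<in> topspace X; b \<in> topspace X\<rbrakk> \<Longrightarrow> closedin X (seg X a b)"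
    and openin_not_beyond: "\<lbrakk>a \<in> topspace X; v \<in> topspace X\<rbrakk> \<Longrightarrow> openin X {b \<in> topspace X. v \<notin> seg X a b}"
    and seg_antisym: "\<lbrakk>a \<in> topspace X; x \<in> seg X a y; y \<in> seg X a x\<rbrakk> \<Longrightarrow> x = y"

lemma dendrite_topological_tree:
  assumes tree: "topological_tree X"
  shows "dendrite X"
proof
  have haus: "Hausdorff_space X" and val: "\<forall>x \<in> topspace X. \<exists>n. has_valence X x n"
    using tree unfolding topological_tree_def topological_graph_def by blast+
  show "compact_space X" "Hausdorff_space X"
    using tree unfolding topological_tree_def topological_graph_def by blast+
  have seg_cases: "(a = b \<and> seg X a b = {a}) \<or> arc_between X (seg X a b) a b"
    if "a \<in> topspace X" "b \<in> topspace X" for a b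
    using that seg_singleton tree_arc_exists[OF tree] tree_seg_eq_arc[OF tree] by metis
  fix a assume a: "a \<in> topspace X"
  show "connectedin X (seg X a b)" if "b \<in> topspace X" for b
    using seg_cases[OF a that] arc_between_props(5) a by (metis connectedin_sing)
  show "closedin X (seg X a b)" if "b \<in> topspace X" for b
    using seg_cases[OF a that] arc_between_props(6) a compactin_imp_closedin[OF haus]
      closedin_Hausdorff_singleton[OF haus] by metis
  show "openin X {b \<in> topspace X. v \<notin> seg X a b}" if v: "v \<in> topspace X" for v
  proof (subst openin_subopen, intro ballI)
    fix b assume "b \<in> {b \<in> topspace X. v \<notin> seg X a b}"
    then obtain C where b: "b \<in> topspace X" and C: "connectedin X C" "a \<in> C" "b \<in> C" "v \<notin> C"
      using v unfolding seg_def by blast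
    have "openin X (topspace X - {v})" using closedin_Hausdorff_singleton[OF haus v] by blast
    moreover have "b \<in> topspace X - {v}" using b C by blast
    moreover have "\<exists>n. has_valence X b n" using val b by blast
    ultimately obtain V where V: "openin X V" "b \<in> V" "V \<subseteq> topspace X - {v}"
        "\<And>z. z \<in> V \<Longrightarrow> z \<noteq> b \<Longrightarrow> \<exists>A\<subseteq>V. arc_between X A b z"
      using local_radial_arcs by metis
    \<comment> \<open>prolong \<open>C\<close> beyond \<open>b\<close> by an arc inside \<open>V\<close>\<close>
    have "V \<subseteq> {b \<in> topspace X. v \<notin> seg X a b}"
    proof
      fix z assume z: "z \<in> V"
      have "\<exists>D. connectedin X D \<and> a \<in> D \<and> z \<in> D \<and> v \<notin> D"
      proof (cases "z = b")
        case True then show ?thesis using C by blast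
      next
        case False
        then obtain A where A: "A \<subseteq> V" "arc_between X A b z" using V(4) z by blast
        have "connectedin X (C \<union> A)"
          using C arc_between_props[OF A(2)] by (intro connectedin_Un) auto
        then show ?thesis using C A V(3) arc_between_props(2)[OF A(2)] by blast
      qed
      then show "z \<in> {b \<in> topspace X. v \<notin> seg X a b}" using z V(3) unfolding seg_def by blast
    qed
    then show "\<exists>T. openin X T \<and> b \<in> T \<and> T \<subseteq> {b \<in> topspace X. v \<notin> seg X a b}" using V by blast
  qed
  show "x = y" if xy: "x \<in> seg X a y" "y \<in> seg X a x" for x y
  proof (rule ccontr)
    assume ne: "x \<noteq> y"
    have X: "x \<in> topspace X" "y \<in> topspace X" using xy unfolding seg_def by blast+
    have "a \<noteq> x" "a \<noteq> y" using xy ne seg_singleton[OF a] by auto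
    then have "arc_between X (seg X a y) a y" using seg_cases[OF a X(2)] by blast
    then obtain B C where BC: "arc_between X B a x" "arc_between X C x y" "B \<inter> C = {x}"
      using arc_between_split[OF _ xy(1)] \<open>a \<noteq> x\<close> ne by metis
    have "y \<notin> B" using BC(3) arc_between_props(2)[OF BC(2)] ne by (metis IntI singletonD)
    then show False using tree_seg_eq_arc[OF tree BC(1)] xy(2) by blast
  qed
qed

text \<open>
  A point of valence at least two is interior to an arc and hence separates the two ends of that arc.
\<close>

lemma endpoint_if_not_separating:
  assumes tree: "topological_tree X" and m: "m \<in> topspace X"
    and sep: "\<And>a b. \<lbrakk>a \<in> topspace X; b \<in> topspace X; a \<noteq> m; b \<noteq> m\<rbrakk> \<Longrightarrow> m \<notin> seg X a b"
  shows "has_valence X m 1"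
proof (rule ccontr)
  assume no: "\<not> has_valence X m 1"
  obtain n where n: "has_valence X m n"
    using tree m unfolding topological_tree_def topological_graph_def by blast
  with no have "n \<noteq> 1" by blast
  then obtain A a b where A: "arc_between X A a b" "m \<in> A" "m \<noteq> a" "m \<noteq> b"
    using arc_through_centre[OF n] by blast
  have "a \<in> topspace X" "b \<in> topspace X" using arc_between_props[OF A(1)] by blast+
  then have "m \<notin> seg X a b" using sep A(3,4) by metis
  then show False using tree_seg_eq_arc[OF tree A(1)] A(2) by blast
qed

text \<open>
  Every point has a neighbourhood, namely a chart, in which it alone can have valence one: any other point
  \<open>y\<close> of the chart is interior to a small arc and therefore separates two points that are as close to \<open>y\<close>
  as desired, whereas a point of valence one has a neighbourhood that it does not disconnect. Compactness
  does the rest.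
\<close>

lemma finite_endpoints:
  assumes tree: "topological_tree X"
  shows "finite {x \<in> topspace X. has_valence X x 1}"
proof -
  have cpt: "compact_space X" and val: "\<forall>x \<in> topspace X. \<exists>n. has_valence X x n"
    using tree unfolding topological_tree_def topological_graph_def by blast+
  have "\<exists>U. openin X U \<and> x \<in> U \<and> (\<forall>y\<in>U. y \<noteq> x \<longrightarrow> \<not> has_valence X y 1)" if x: "x \<in> topspace X" for x
  proof -
    obtain n U g where ch: "openin X U" "x \<in> U"
      "homeomorphic_map (subtopology X U) (top_of_set (open_star n)) g" "g x = 0"
      using val x unfolding has_valence_def by blast
    have "\<not> has_valence X y 1" if y: "y \<in> U" "y \<noteq> x" for y
    proof
      assume "has_valence X y 1"
      then obtain V h where V: "openin X V" "y \<in> V"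
        "homeomorphic_map (subtopology X V) (top_of_set (open_star 1)) h" "h y = 0"
        unfolding has_valence_def by blast
      obtain A a b where A: "arc_between X A a b" "A \<subseteq> V" "y \<in> A" "y \<noteq> a" "y \<noteq> b"
        using arc_through_branch_point[OF ch(1,3,2,4) y V(1,2)] by blast
      \<comment> \<open>removing the tip of a half-open interval leaves it connected\<close>
      obtain k e where k: "continuous_map (top_of_set (open_star 1)) X k" "inj_on k (open_star 1)" "k 0 = y"
        "k ` open_star 1 = V" "\<forall>z\<in>open_star 1. h (k z) = z" "\<forall>y\<in>V. k (h y) = y"
        "0 < e" "e < 1" "\<forall>z\<in>open_star 1. cmod z < e \<longrightarrow> k z \<in> V"
        "openin X (k ` (open_star 1 \<inter> ball 0 e))"
        using chart_ball[OF V(1,2) V] .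
      have star1: "open_star 1 = of_real ` {0..<1}" unfolding open_star_def by auto
      then have "0 \<in> open_star 1" by force
      have "continuous_map (top_of_set {0<..<1}) (top_of_set (open_star 1)) (of_real :: real \<Rightarrow> complex)"
        unfolding star1 by (auto simp: continuous_map_in_subtopology intro!: continuous_intros)
      then have "continuous_map (top_of_set {0<..<1}) X (k \<circ> of_real)"
        using k(1) continuous_map_compose by blast
      moreover have "connectedin (top_of_set {0<..<1::real}) {0<..<1}"
        by (auto simp: connectedin_subtopology)
      ultimately have conn: "connectedin X ((k \<circ> of_real) ` {0<..<1})"
        by (rule connectedin_continuous_map_image)
      have im: "(k \<circ> of_real) ` {0<..<1} = V - {y}"
      proof -
        have "(k \<circ> of_real) ` {0<..<1} = k ` (open_star 1 - {0})"
          unfolding star1 image_comp[symmetric] by (rule arg_cong[of _ _ "image k"]) force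
        also have "\<dots> = k ` open_star 1 - k ` {0}"
          using \<open>0 \<in> open_star 1\<close> by (intro inj_on_image_set_diff[OF k(2)]) blast+
        finally show ?thesis using k(3,4) by simp
      qed
      have "a \<in> V - {y}" "b \<in> V - {y}" using A arc_between_props(1,2)[OF A(1)] by blast+
      then have "seg X a b \<subseteq> V - {y}" using conn im by (intro seg_subset_connectedin) auto
      then show False using tree_seg_eq_arc[OF tree A(1)] A(3) by blast
    qed
    then show ?thesis using ch by blast
  qed
  then obtain U where U: "\<And>x. x \<in> topspace X \<Longrightarrow> openin X (U x) \<and> x \<in> U x \<and> (\<forall>y\<in>U x. y \<noteq> x \<longrightarrow> \<not> has_valence X y 1)"
    by metis
  have "compactin X (topspace X)" using cpt by (simp add: compact_space_def)
  moreover have "\<forall>V\<in>U ` topspace X. openin X V" "topspace X \<subseteq> \<Union> (U ` topspace X)" using U by auto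
  ultimately obtain F where F: "finite F" "F \<subseteq> U ` topspace X" "topspace X \<subseteq> \<Union>F"
    unfolding compactin_def by meson
  then obtain G where G: "finite G" "G \<subseteq> topspace X" "F = U ` G"
    by (meson finite_subset_image)
  have "{x \<in> topspace X. has_valence X x 1} \<subseteq> G"
  proof
    fix y assume y: "y \<in> {x \<in> topspace X. has_valence X x 1}"
    then obtain x where x: "x \<in> G" "y \<in> U x" using F(3) unfolding G(3) by blast
    then have "y = x" using U[of x] G(2) y by blast
    then show "y \<in> G" using x(1) by simp
  qed
  then show ?thesis using G(1) finite_subset by blast
qed

section \<open>The order of a rooted tree and expanding points\<close>

text \<open>
  The component of \<open>w\<close> in the complement of \<open>h\<close>.
\<close>

definition side :: "'a topology \<Rightarrow> 'a \<Rightarrow> 'a \<Rightarrow> 'a set" where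
  "side X h w = {y \<in> topspace X. h \<notin> seg X w y}"

text \<open>
  For the root \<open>h\<close>, the point \<open>m\<close> is a least upper bound of the chain \<open>C\<close> and at the same time a cluster
  point of each of its tails. The second property transports statements about images under a
  continuous map from \<open>C\<close> to \<open>m\<close>.
\<close>

definition chain_limit :: "'a topology \<Rightarrow> 'a \<Rightarrow> 'a set \<Rightarrow> 'a \<Rightarrow> bool" where
  "chain_limit X h C m \<longleftrightarrow> (\<forall>x\<in>C. \<forall>y\<in>C. x \<in> seg X h y \<or> y \<in> seg X h x) \<and> m \<in> topspace X \<and> (\<forall>c\<in>C. c \<in> seg X h m) \<and>
    (\<forall>z\<in>topspace X. (\<forall>c\<in>C. c \<in> seg X h z) \<longrightarrow> m \<in> seg X h z) \<and>
    (\<forall>c\<in>C. m \<in> X closure_of {c' \<in> C. c \<in> seg X h c'})"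

lemma seg_subset_topspace: "seg X a b \<subseteq> topspace X"
  unfolding seg_def by blast

lemma seg_in_topspace: "x \<in> seg X a b \<Longrightarrow> x \<in> topspace X"
  unfolding seg_def by blast

lemma endpoints_in_seg:
  assumes "a \<in> topspace X" "b \<in> topspace X" shows "a \<in> seg X a b" "b \<in> seg X a b"
  using assms unfolding seg_def by blast+

lemma not_in_seg_trans:
  assumes "v \<in> topspace X" "v \<notin> seg X a b" "v \<notin> seg X b c"
  shows "v \<notin> seg X a c"
proof -
  obtain C where C: "connectedin X C" "a \<in> C" "b \<in> C" "v \<notin> C" using assms(1,2) unfolding seg_def by blast
  obtain D where D: "connectedin X D" "b \<in> D" "c \<in> D" "v \<notin> D" using assms(1,3) unfolding seg_def by blast
  have "connectedin X (C \<union> D)" using C D by (intro connectedin_Un) auto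
  then show ?thesis using C D unfolding seg_def by blast
qed

lemma side_eqI:
  assumes "h \<in> topspace X" "h \<notin> seg X w y"
  shows "side X h w = side X h y"
  using not_in_seg_trans[OF assms(1)] assms(2) unfolding side_def seg_commute[of X w y]
  by (metis seg_commute)

context dendrite
begin

lemma seg_mono:
  assumes "a \<in> topspace X" "b \<in> topspace X" "x \<in> seg X a b"
  shows "seg X a x \<subseteq> seg X a b" "seg X x b \<subseteq> seg X a b"
  by (rule seg_subset_connectedin[OF connectedin_seg[OF assms(1,2)]];
      use assms endpoints_in_seg[OF assms(1,2)] in blast)+

lemma seg_trans:
  assumes "h \<in> topspace X" "z \<in> topspace X" "x \<in> seg X h y" "y \<in> seg X h z"
  shows "x \<in> seg X h z"
  using seg_mono(1)[OF assms(1,2,4)] assms(3) by blast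

lemma seg_linear:
  assumes "h \<in> topspace X" "e \<in> topspace X" "x \<in> seg X h e" "y \<in> seg X h e"
  shows "x \<in> seg X h y \<or> y \<in> seg X h x"
proof (rule ccontr)
  assume no: "\<not> ?thesis"
  have X: "x \<in> topspace X" "y \<in> topspace X" using assms(3,4) by (auto dest: seg_in_topspace)
  \<comment> \<open>a detour around \<open>x\<close> to \<open>y\<close> forces \<open>x\<close> to lie between \<open>y\<close> and \<open>e\<close>, and vice versa\<close>
  have "x \<in> seg X y e" using not_in_seg_trans[OF X(1), of h y e] no assms(3) by blast
  moreover have "y \<in> seg X x e" using not_in_seg_trans[OF X(2), of h x e] no assms(4) by blast
  ultimately have "x = y" using seg_antisym[OF assms(2)] by (simp add: seg_commute)
  then show False using no endpoints_in_seg[OF assms(1) X(1)] by blast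
qed

lemma seg_accumulates_at_end:
  assumes "a \<in> topspace X" "b \<in> topspace X" "a \<noteq> b" "openin X U" "a \<in> U"
  obtains x where "x \<in> seg X a b" "x \<in> U" "x \<noteq> a"
proof -
  have "openin X (topspace X - {a})" using closedin_Hausdorff_singleton[OF Hausdorff assms(1)] by blast
  moreover have "seg X a b \<subseteq> U \<union> (topspace X - {a})" using assms(5) seg_subset_topspace[of X a b] by blast
  moreover have "U \<inter> seg X a b \<noteq> {}" "(topspace X - {a}) \<inter> seg X a b \<noteq> {}"
    using endpoints_in_seg[OF assms(1,2)] assms by blast+
  ultimately have "U \<inter> (topspace X - {a}) \<inter> seg X a b \<noteq> {}"
    using connectedin_seg[OF assms(1,2)] assms(4) unfolding connectedin by blast
  then show ?thesis using that by blast
qed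

lemma closedin_beyond:
  assumes "h \<in> topspace X" "v \<in> topspace X"
  shows "closedin X {b \<in> topspace X. v \<in> seg X h b}"
proof -
  have "topspace X - {b \<in> topspace X. v \<in> seg X h b} = {b \<in> topspace X. v \<notin> seg X h b}" by blast
  then show ?thesis using openin_not_beyond[OF assms] unfolding closedin_def by auto
qed

lemma openin_side:
  assumes "h \<in> topspace X" "w \<in> topspace X" shows "openin X (side X h w)"
  unfolding side_def using openin_not_beyond[OF assms(2,1)] .

text \<open>
  A cluster point of the tails exists by compactness. It is an upper bound because the points beyond a
  given one form a closed set, and the least one because segments are closed.
\<close>

lemma chain_limit_exists:
  assumes h: "h \<in> topspace X" and C: "C \<subseteq> topspace X" "C \<noteq> {}"
    and chain: "\<And>x y. x \<in> C \<Longrightarrow> y \<in> C \<Longrightarrow> x \<in> seg X h y \<or> y \<in> seg X h x"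
  shows "\<exists>m. chain_limit X h C m"
proof -
  define T where "T c = {c' \<in> C. c \<in> seg X h c'}" for c
  have TX: "T c \<subseteq> topspace X" for c using C(1) unfolding T_def by blast
  have tr: "T b \<subseteq> T a" if "b \<in> C" "a \<in> seg X h b" for a b
    using seg_trans[OF h _ that(2)] C(1) unfolding T_def by blast
  have "\<Inter>((\<lambda>c. X closure_of T c) ` C) \<noteq> {}"
  proof (rule compact_space_fip[THEN iffD1, OF compact, rule_format], intro conjI ballI allI impI)
    show "closedin X K" if "K \<in> (\<lambda>c. X closure_of T c) ` C" for K using that by auto
    fix F assume F: "finite F \<and> F \<subseteq> (\<lambda>c. X closure_of T c) ` C"
    then obtain D where D: "finite D" "D \<subseteq> C" "F = (\<lambda>c. X closure_of T c) ` D"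
      by (metis finite_subset_image)
    have "\<exists>b\<in>C. \<forall>a\<in>D. a \<in> seg X h b" using D(1,2)
    proof (induction D rule: finite_induct)
      case empty then show ?case using C(2) by blast
    next
      case (insert a D)
      then obtain b where b: "b \<in> C" "\<forall>a\<in>D. a \<in> seg X h b" by blast
      have aX: "a \<in> C" "a \<in> topspace X" "b \<in> topspace X" using insert b C(1) by auto
      show ?case
      proof (cases "a \<in> seg X h b")
        case True then show ?thesis using b by blast
      next
        case False
        then have "b \<in> seg X h a" using chain[OF aX(1) b(1)] by blast
        then have "\<forall>c\<in>D. c \<in> seg X h a" using seg_trans[OF h aX(2)] b(2) by blast
        then show ?thesis using aX endpoints_in_seg[OF h aX(2)] by blast
      qed
    qed
    then obtain b where b: "b \<in> C" "\<forall>a\<in>D. a \<in> seg X h b" by blast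
    have "b \<in> X closure_of T a" if "a \<in> D" for a
    proof -
      have "b \<in> T a" using b that unfolding T_def by blast
      then show ?thesis using closure_of_subset[OF TX] by blast
    qed
    then show "\<Inter>F \<noteq> {}" unfolding D(3) by blast
  qed
  then obtain m where m: "\<And>c. c \<in> C \<Longrightarrow> m \<in> X closure_of T c" by blast
  have mX: "m \<in> topspace X" using C(2) m closure_of_subset_topspace[of X] by blast
  have "c \<in> seg X h m" if c: "c \<in> C" for c
  proof -
    have "T c \<subseteq> {b \<in> topspace X. c \<in> seg X h b}" using C(1) unfolding T_def by blast
    then have "X closure_of T c \<subseteq> {b \<in> topspace X. c \<in> seg X h b}"
      by (rule closure_of_minimal) (use c C(1) h in \<open>auto intro: closedin_beyond\<close>)
    then show ?thesis using m[OF c] by blast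
  qed
  moreover have "m \<in> seg X h z" if z: "z \<in> topspace X" "\<forall>c\<in>C. c \<in> seg X h z" for z
  proof -
    obtain c where c: "c \<in> C" using C(2) by blast
    have "T c \<subseteq> seg X h z" using z unfolding T_def by blast
    then have "X closure_of T c \<subseteq> seg X h z" by (rule closure_of_minimal) (rule closedin_seg[OF h z(1)])
    then show ?thesis using m[OF c] by blast
  qed
  ultimately show ?thesis using m mX chain unfolding chain_limit_def T_def by blast
qed

lemma maximal_point_exists:
  assumes h: "h \<in> topspace X" and A: "A \<subseteq> topspace X" "A \<noteq> {}"
    and lim: "\<And>C m. \<lbrakk>C \<subseteq> A; C \<noteq> {}; chain_limit X h C m\<rbrakk> \<Longrightarrow> m \<in> A"
  shows "\<exists>m\<in>A. \<forall>x\<in>A. m \<in> seg X h x \<longrightarrow> x = m"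
proof -
  have "\<exists>M\<in>seg X h ` A. \<forall>S\<in>seg X h ` A. M \<subseteq> S \<longrightarrow> S = M"
  proof (rule subset_Zorn)
    fix \<C> assume "subset.chain (seg X h ` A) \<C>"
    then have ch: "\<C> \<subseteq> seg X h ` A" "\<And>S T. S \<in> \<C> \<Longrightarrow> T \<in> \<C> \<Longrightarrow> S \<subseteq> T \<or> T \<subseteq> S"
      unfolding subset_chain_def by blast+
    define C where "C = {x \<in> A. seg X h x \<in> \<C>}"
    show "\<exists>U\<in>seg X h ` A. \<forall>S\<in>\<C>. S \<subseteq> U"
    proof (cases "\<C> = {}")
      case True then show ?thesis using A(2) by blast
    next
      case False
      have CA: "C \<subseteq> A" unfolding C_def by blast
      have CC: "\<C> = seg X h ` C" using ch(1) unfolding C_def by blast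
      have ne: "C \<noteq> {}" using CC False by blast
      have lin: "x \<in> seg X h y \<or> y \<in> seg X h x" if "x \<in> C" "y \<in> C" for x y
      proof -
        have "x \<in> seg X h x" "y \<in> seg X h y" using that CA A(1) endpoints_in_seg(2)[OF h] by blast+
        then show ?thesis using ch(2)[of "seg X h x" "seg X h y"] that unfolding C_def by blast
      qed
      obtain m where m: "chain_limit X h C m"
        using chain_limit_exists[OF h _ ne lin] CA A(1) by blast
      have mA: "m \<in> A" using lim[OF CA ne m] .
      have "seg X h c \<subseteq> seg X h m" if "c \<in> C" for c
        using seg_mono(1)[OF h] m that unfolding chain_limit_def by blast
      then show ?thesis using mA unfolding CC by blast
    qed
  qed
  then obtain m where m: "m \<in> A" "\<forall>x\<in>A. seg X h m \<subseteq> seg X h x \<longrightarrow> seg X h x = seg X h m" by blast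
  have "x = m" if x: "x \<in> A" "m \<in> seg X h x" for x
  proof -
    have "x \<in> topspace X" using x(1) A(1) by blast
    then have "seg X h m \<subseteq> seg X h x" by (intro seg_mono(1)[OF h] x(2))
    then have "seg X h x = seg X h m" using m(2) x(1) by blast
    then have "x \<in> seg X h m" using endpoints_in_seg(2)[OF h \<open>x \<in> topspace X\<close>] by blast
    then show ?thesis using seg_antisym[OF h] x(2) by blast
  qed
  then show ?thesis using m(1) by blast
qed

text \<open>
  The fixed point principle behind all that follows, for the order with root \<open>h\<close>. The points \<open>x \<ge> v\<close> that
  \<open>g\<close> moves away from the root, \<open>x \<le> g x\<close>, and that still have a point of \<open>P\<close> beyond them are closed
  under limits of chains; let \<open>m\<close> be a maximal one. If \<open>g m\<close> were in the same component of the complement of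
  \<open>m\<close> as some \<open>q \<in> P\<close>, then the segments from \<open>m\<close> to \<open>g m\<close> and to \<open>q\<close> would start with a common piece, and
  by continuity the points on it close to \<open>m\<close> would again belong to the set, against maximality.

  With \<open>P\<close> the whole space the conclusion says \<open>g m = m\<close>. With \<open>P\<close> a cycle it gives the point around which
  the cycle is studied.
\<close>

lemma maximal_expanding_point:
  assumes h: "h \<in> topspace X" and g: "continuous_map X X g" and P: "closedin X P"
    and v: "v \<in> topspace X" "v \<in> seg X h (g v)" "q0 \<in> P" "v \<in> seg X h q0"
  obtains m q where "m \<in> topspace X" "v \<in> seg X h m" "m \<in> seg X h (g m)" "q \<in> P" "m \<in> seg X h q"
    "\<And>q. q \<in> P \<Longrightarrow> m \<in> seg X (g m) q"
proof -
  have gX: "g x \<in> topspace X" if "x \<in> topspace X" for x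
    using g that by (auto simp: continuous_map_def)
  have PX: "P \<subseteq> topspace X" using P by (rule closedin_subset)
  define A where "A = {x \<in> topspace X. v \<in> seg X h x \<and> x \<in> seg X h (g x) \<and> (\<exists>q\<in>P. x \<in> seg X h q)}"
  have AX: "A \<subseteq> topspace X" unfolding A_def by blast
  have "v \<in> A" using v endpoints_in_seg(2)[OF h v(1)] unfolding A_def by blast
  then have Ane: "A \<noteq> {}" by blast
  have lim: "m \<in> A" if C: "C \<subseteq> A" "C \<noteq> {}" and m: "chain_limit X h C m" for C m
  proof -
    have lin: "\<And>x y. x \<in> C \<Longrightarrow> y \<in> C \<Longrightarrow> x \<in> seg X h y \<or> y \<in> seg X h x"
      using m unfolding chain_limit_def by blast
    have mX: "m \<in> topspace X" and mub: "\<And>c. c \<in> C \<Longrightarrow> c \<in> seg X h m"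
      and mlub: "\<And>z. z \<in> topspace X \<Longrightarrow> \<forall>c\<in>C. c \<in> seg X h z \<Longrightarrow> m \<in> seg X h z"
      and mcl: "\<And>c. c \<in> C \<Longrightarrow> m \<in> X closure_of {c' \<in> C. c \<in> seg X h c'}"
      using m unfolding chain_limit_def by blast+
    obtain c0 where c0: "c0 \<in> C" using C(2) by blast
    have "v \<in> seg X h c0" using c0 C(1) unfolding A_def by blast
    then have vm: "v \<in> seg X h m" using seg_trans[OF h mX _ mub[OF c0]] by blast
    have "c \<in> seg X h (g m)" if c: "c \<in> C" for c
    proof -
      let ?K = "{b \<in> topspace X. c \<in> seg X h b}"
      have cX: "c \<in> topspace X" using c C(1) AX by blast
      have "closedin X {x \<in> topspace X. g x \<in> ?K}"
        by (rule closedin_continuous_map_preimage[OF g closedin_beyond[OF h cX]])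
      moreover have "{c' \<in> C. c \<in> seg X h c'} \<subseteq> {x \<in> topspace X. g x \<in> ?K}"
      proof
        fix c' assume "c' \<in> {c' \<in> C. c \<in> seg X h c'}"
        then have c': "c' \<in> C" "c \<in> seg X h c'" by blast+
        then have "c' \<in> A" using C(1) by blast
        then have X': "c' \<in> topspace X" "c' \<in> seg X h (g c')" unfolding A_def by blast+
        then show "c' \<in> {x \<in> topspace X. g x \<in> ?K}"
          using gX seg_trans[OF h gX c'(2)] by blast
      qed
      ultimately have "X closure_of {c' \<in> C. c \<in> seg X h c'} \<subseteq> {x \<in> topspace X. g x \<in> ?K}"
        by (intro closure_of_minimal)
      then show ?thesis using mcl[OF c] by blast
    qed
    then have mg: "m \<in> seg X h (g m)" using mlub[OF gX[OF mX]] by blast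
    \<comment> \<open>by compactness some point of \<open>P\<close> lies beyond the whole chain\<close>
    define K where "K c = P \<inter> {b \<in> topspace X. c \<in> seg X h b}" for c
    have "\<Inter>(K ` C) \<noteq> {}"
    proof (rule compact_space_fip[THEN iffD1, OF compact, rule_format], intro conjI ballI allI impI)
      fix S assume "S \<in> K ` C"
      then obtain c where c: "c \<in> C" "S = K c" by blast
      have "c \<in> topspace X" using c(1) C(1) AX by blast
      then show "closedin X S" unfolding c(2) K_def by (intro closedin_Int P closedin_beyond h)
    next
      fix F assume F: "finite F \<and> F \<subseteq> K ` C"
      obtain D where D: "finite D" "D \<subseteq> C" "F = K ` D"
        using finite_subset_image[OF conjunct1[OF F] conjunct2[OF F]] by metis
      have "\<exists>q\<in>P. \<forall>c\<in>D. c \<in> seg X h q"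
      proof (cases "D = {}")
        case True then show ?thesis using v(3) by blast
      next
        case False
        have "\<exists>b\<in>D. \<forall>a\<in>D. a \<in> seg X h b" using D(1) False D(2)
        proof (induction D rule: finite_ne_induct)
          case (singleton x)
          then show ?case using endpoints_in_seg(2)[OF h] C(1) AX by blast
        next
          case (insert a D)
          then obtain b where b: "b \<in> D" "\<forall>a\<in>D. a \<in> seg X h b" by blast
          have aX: "a \<in> C" "b \<in> C" "a \<in> topspace X" "b \<in> topspace X" using insert b C(1) AX by auto
          show ?case
          proof (cases "a \<in> seg X h b")
            case True then show ?thesis using b by blast
          next
            case False
            then have "b \<in> seg X h a" using lin[OF aX(1,2)] by blast
            then have "\<forall>c\<in>D. c \<in> seg X h a" using seg_trans[OF h aX(3)] b(2) by blast
            then show ?thesis using endpoints_in_seg(2)[OF h aX(3)] by blast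
          qed
        qed
        then obtain b where b: "b \<in> D" "\<forall>a\<in>D. a \<in> seg X h b" by blast
        then obtain q where q: "q \<in> P" "b \<in> seg X h q" using D(2) C(1) unfolding A_def by blast
        then show ?thesis using seg_trans[OF h _ _ q(2)] PX b(2) by blast
      qed
      then show "\<Inter>F \<noteq> {}" unfolding D(3) K_def using PX by blast
    qed
    then obtain q where q: "\<forall>c\<in>C. q \<in> P \<and> c \<in> seg X h q" unfolding K_def by blast
    then have "q \<in> P" "m \<in> seg X h q" using c0 mlub[of q] PX by blast+
    then show "m \<in> A" using mX vm mg unfolding A_def by blast
  qed
  have "\<exists>m\<in>A. \<forall>x\<in>A. m \<in> seg X h x \<longrightarrow> x = m"
    by (rule maximal_point_exists[OF h AX Ane]) (rule lim)
  then obtain m where m: "m \<in> A" "\<forall>x\<in>A. m \<in> seg X h x \<longrightarrow> x = m" by blast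
  then have mX: "m \<in> topspace X" and vm: "v \<in> seg X h m" and mg: "m \<in> seg X h (g m)"
    unfolding A_def by blast+
  have "m \<in> seg X (g m) q" if q: "q \<in> P" for q
  proof (rule ccontr)
    assume no: "m \<notin> seg X (g m) q"
    have qX: "q \<in> topspace X" and gmX: "g m \<in> topspace X" using q PX gX[OF mX] by blast+
    have ne: "g m \<noteq> m" "q \<noteq> m" using no endpoints_in_seg[OF gmX qX] by auto
    have mq: "m \<in> seg X h q" using not_in_seg_trans[OF mX, of h q "g m"] mg no seg_commute[of X q] by blast
    \<comment> \<open>the segments from \<open>m\<close> to \<open>g m\<close> and to \<open>q\<close> leave \<open>m\<close> together\<close>
    have "\<exists>x1. x1 \<in> seg X m q \<and> x1 \<in> seg X m (g m) \<and> x1 \<noteq> m"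
    proof (rule ccontr)
      assume disj: "\<not> ?thesis"
      obtain D where D: "connectedin X D" "g m \<in> D" "q \<in> D" "m \<notin> D" using no mX unfolding seg_def by blast
      let ?S = "seg X (g m) q"
      have "?S \<subseteq> seg X m (g m) \<union> seg X m q"
      proof (rule seg_subset_connectedin)
        show "connectedin X (seg X m (g m) \<union> seg X m q)"
          using connectedin_seg[OF mX gmX] connectedin_seg[OF mX qX] endpoints_in_seg(1)[OF mX]
          using gmX qX by (intro connectedin_Un) auto
      qed (use endpoints_in_seg(2)[OF mX] gmX qX in auto)
      then have "?S \<subseteq> (seg X m (g m)) \<union> (seg X m q)" "seg X m (g m) \<inter> seg X m q \<inter> ?S = {}"
        using disj no by blast+
      moreover have "seg X m (g m) \<inter> ?S \<noteq> {}" "seg X m q \<inter> ?S \<noteq> {}"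
        using endpoints_in_seg[OF gmX qX] endpoints_in_seg(2)[OF mX] gmX qX by blast+
      ultimately show False
        using connectedin_seg[OF gmX qX] closedin_seg[OF mX gmX] closedin_seg[OF mX qX]
        unfolding connectedin_closedin by blast
    qed
    then obtain x1 where x1: "x1 \<in> seg X m q" "x1 \<in> seg X m (g m)" "x1 \<noteq> m" by blast
    have x1X: "x1 \<in> topspace X" using x1(1) by (rule seg_in_topspace)
    have beyond_m: "m \<in> seg X h x" if x: "x \<in> seg X m y" "m \<in> seg X h y" "y \<in> topspace X" for x y
    proof (rule ccontr)
      assume c: "m \<notin> seg X h x"
      then have "m \<in> seg X x y" using not_in_seg_trans[OF mX, of h x y] x(2) by blast
      then have "x = m" using seg_antisym[OF x(3), of x m] x(1) by (simp add: seg_commute)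
      then show False using c endpoints_in_seg(2)[OF h mX] by blast
    qed
    have "openin X (topspace X - {g m})" using closedin_Hausdorff_singleton[OF Hausdorff gmX] by blast
    moreover have "m \<in> topspace X - {g m}" using ne mX by auto
    ultimately obtain x0 where "x0 \<in> seg X m x1" "x0 \<in> topspace X - {g m}" "x0 \<noteq> m"
      by (rule seg_accumulates_at_end[OF mX x1X x1(3)[symmetric]])
    then have x0: "x0 \<in> seg X m x1" "x0 \<noteq> g m" "x0 \<noteq> m" by blast+
    have x0X: "x0 \<in> topspace X" using x0(1) by (rule seg_in_topspace)
    have x0q: "x0 \<in> seg X m q" "x0 \<in> seg X m (g m)"
      using seg_mono(1)[OF mX qX x1(1)] seg_mono(1)[OF mX gmX x1(2)] x0 by blast+
    have mx0: "m \<in> seg X h x0" using beyond_m[OF x0q(1) mq qX] .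
    have x0q': "x0 \<in> seg X h q" "x0 \<in> seg X h (g m)"
      using seg_mono(2)[OF h qX mq] seg_mono(2)[OF h gmX mg] x0q by blast+
    let ?O = "side X x0 (g m)"
    have "openin X {x \<in> topspace X. g x \<in> ?O}"
      by (rule openin_continuous_map_preimage[OF g openin_side[OF x0X gmX]])
    moreover have "g m \<in> ?O" unfolding side_def using seg_singleton[OF gmX] gmX x0(2) by simp
    then have "m \<in> {x \<in> topspace X. g x \<in> ?O}" using mX by blast
    ultimately obtain x where "x \<in> seg X m x0" "x \<in> {x \<in> topspace X. g x \<in> ?O}" "x \<noteq> m"
      by (rule seg_accumulates_at_end[OF mX x0X x0(3)[symmetric]])
    then have x: "x \<in> seg X m x0" "g x \<in> ?O" "x \<noteq> m" by blast+
    have xX: "x \<in> topspace X" using x(1) by (rule seg_in_topspace)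
    have xx0: "x \<in> seg X h x0" using seg_mono(2)[OF h x0X mx0] x(1) by blast
    have "x0 \<in> seg X h (g x)"
    proof (rule ccontr)
      assume "x0 \<notin> seg X h (g x)"
      moreover have "x0 \<notin> seg X (g x) (g m)" using x(2) seg_commute[of X "g x"] unfolding side_def by simp
      ultimately show False using not_in_seg_trans[OF x0X, of h "g x" "g m"] x0q'(2) by blast
    qed
    then have "x \<in> seg X h (g x)" using seg_trans[OF h gX[OF xX] xx0] by blast
    moreover have "x \<in> seg X h q" using seg_trans[OF h qX xx0 x0q'(1)] .
    moreover have mx: "m \<in> seg X h x" using beyond_m[OF x(1) mx0 x0X] .
    moreover have "v \<in> seg X h x" using seg_trans[OF h xX vm mx] .
    ultimately have "x \<in> A" using q xX unfolding A_def by blast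
    then show False using m(2) mx x(3) by blast
  qed
  then show ?thesis using that m(1) unfolding A_def by blast
qed

end

section \<open>Pivots and closed walks of a cycle\<close>

context dendrite
begin

text \<open>
  A pivot \<open>h\<close> for a cycle \<open>P\<close>: a point that separates two points of \<open>P\<close> and whose image lies in no
  component of the complement of \<open>h\<close> that meets \<open>P\<close>. The point \<open>h\<close> need not be fixed, but as far as the
  components that meet \<open>P\<close> are concerned it behaves like a fixed point. It is a maximal expanding point for
  an order rooted at a point of \<open>P\<close>.
\<close>

lemma pivot_exists:
  assumes f: "continuous_map X X f" and P: "finite P" "P \<noteq> {}" "P \<subseteq> topspace X"
    "\<And>x. x \<in> P \<Longrightarrow> f x \<in> P" "\<And>x. x \<in> P \<Longrightarrow> f x \<noteq> x"
  obtains h x y where "h \<in> topspace X" "h \<notin> P" "\<And>w. w \<in> P \<Longrightarrow> h \<in> seg X (f h) w"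
    "x \<in> P" "y \<in> P" "h \<in> seg X x y"
proof -
  obtain x0 where x0: "x0 \<in> P" using P(2) by blast
  have x0X: "x0 \<in> topspace X" "f x0 \<in> topspace X" using x0 P(3,4) by blast+
  have clP: "closedin X P" using closedin_Hausdorff_finite[OF Hausdorff P(3,1)] .
  obtain h q where h: "h \<in> topspace X" "h \<in> seg X x0 (f h)" "q \<in> P" "h \<in> seg X x0 q"
    and away: "\<And>q. q \<in> P \<Longrightarrow> h \<in> seg X (f h) q"
    using maximal_expanding_point[OF x0X(1) f clP x0X(1) endpoints_in_seg(1)[OF x0X] x0
        endpoints_in_seg(1)[OF x0X(1) x0X(1)]] by metis
  have "h \<notin> P"
  proof
    assume hP: "h \<in> P"
    then have "f h \<in> topspace X" using P(3,4) by blast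
    then have "h \<in> {f h}" using away[OF P(4)[OF hP]] seg_singleton by metis
    then show False using P(5)[OF hP] by simp
  qed
  then show ?thesis using that h x0 away by blast
qed

text \<open>
  The image of the segment from \<open>h\<close> to \<open>w\<close> is connected and joins \<open>f h\<close> to \<open>f w\<close>, so it contains \<open>h\<close> and
  with it the whole segment from \<open>h\<close> to \<open>f w\<close>.
\<close>

lemma seg_lifts:
  assumes f: "continuous_map X X f" and h: "h \<in> topspace X" and w: "w \<in> topspace X"
    and "h \<in> seg X (f h) (f w)" "u \<in> seg X h (f w)"
  obtains v where "v \<in> seg X h w" "f v = u"
proof -
  have conn: "connectedin X (f ` seg X h w)"
    using connectedin_continuous_map_image[OF f connectedin_seg[OF h w]] .
  have "f h \<in> f ` seg X h w" "f w \<in> f ` seg X h w" using endpoints_in_seg[OF h w] by blast+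
  then have "h \<in> f ` seg X h w" using seg_subset_connectedin[OF conn] assms(4) by blast
  then have "u \<in> f ` seg X h w" using seg_subset_connectedin[OF conn] \<open>f w \<in> f ` seg X h w\<close> assms(5) by blast
  then show ?thesis using that by blast
qed

text \<open>
  Order the tree by the root \<open>h\<close> and draw an arrow from \<open>w\<close> to \<open>w'\<close> in \<open>P\<close> whenever \<open>w' \<le> f w\<close>. Along a walk
  in this graph the end point can be pulled back step by step: the segment from \<open>h\<close> to each vertex covers
  the segment from \<open>h\<close> to the next one.
\<close>

lemma walk_is_shadowed:
  assumes f: "continuous_map X X f" and h: "h \<in> topspace X" and P: "P \<subseteq> topspace X" "h \<notin> P"
    "\<And>x. x \<in> P \<Longrightarrow> f x \<in> P" "\<And>w. w \<in> P \<Longrightarrow> h \<in> seg X (f h) w"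
  shows "\<lbrakk>\<forall>i\<le>n. w i \<in> P; \<forall>i<n. w (Suc i) \<in> seg X h (f (w i))\<rbrakk> \<Longrightarrow>
    \<exists>v. (\<forall>i\<le>n. (f ^^ i) v \<in> seg X h (w i) \<and> (f ^^ i) v \<noteq> h) \<and> (f ^^ n) v = w n"
proof (induction n arbitrary: w)
  case 0
  then have "w 0 \<in> P" by simp
  then have "w 0 \<in> seg X h (w 0)" "w 0 \<noteq> h" using P(1,2) endpoints_in_seg(2)[OF h] by blast+
  then show ?case by (intro exI[of _ "w 0"]) simp
next
  case (Suc n)
  have wP: "w 0 \<in> P" "w (Suc 0) \<in> P" and w1: "w (Suc 0) \<in> seg X h (f (w 0))" using Suc.prems by auto
  have X: "w 0 \<in> topspace X" "f (w 0) \<in> topspace X" "w (Suc 0) \<in> topspace X" using wP P(1,3) by blast+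
  have "\<forall>i\<le>n. w (Suc i) \<in> P" "\<forall>i<n. w (Suc (Suc i)) \<in> seg X h (f (w (Suc i)))"
    using Suc.prems by auto
  from Suc.IH[OF this] obtain v' where
    v': "\<forall>i\<le>n. (f ^^ i) v' \<in> seg X h (w (Suc i)) \<and> (f ^^ i) v' \<noteq> h" "(f ^^ n) v' = w (Suc n)"
    by blast
  have v'1: "v' \<in> seg X h (w (Suc 0))" "v' \<noteq> h" using v'(1) by force+
  have "v' \<in> seg X h (f (w 0))" using seg_trans[OF h X(2) v'1(1) w1] .
  then obtain v where v: "v \<in> seg X h (w 0)" "f v = v'"
    using seg_lifts[OF f h X(1) P(4)[OF P(3)[OF wP(1)]]] by blast
  have "v \<noteq> h"
  proof
    assume "v = h"
    then have "h \<in> seg X v' (w (Suc 0))" using P(4)[OF wP(2)] v(2) by simp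
    then have "h = v'"
      using seg_antisym[OF X(3), of h v'] v'1(1) by (simp add: seg_commute)
    then show False using v'1 by simp
  qed
  moreover have it: "(f ^^ Suc i) v = (f ^^ i) v'" for i using v(2) by (simp add: funpow_swap1)
  moreover have "(f ^^ i) v \<in> seg X h (w i) \<and> (f ^^ i) v \<noteq> h" if "i \<le> Suc n" for i
  proof (cases i)
    case 0 then show ?thesis using v(1) \<open>v \<noteq> h\<close> by simp
  next
    case (Suc j) then show ?thesis using v'(1) it[of j] that by simp
  qed
  ultimately show ?case using v'(2) by (intro exI[of _ v] conjI allI impI) simp_all
qed

lemma continuous_map_collapse_to_side:
  assumes h: "h \<in> topspace X" and w: "w \<in> topspace X"
  shows "continuous_map X X (\<lambda>z. if z \<in> side X h w then z else h)"
proof (rule continuous_map_alt[THEN iffD2], intro conjI allI impI)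
  let ?S = "side X h w"
  let ?r = "\<lambda>z. if z \<in> ?S then z else h"
  show "?r \<in> topspace X \<rightarrow> topspace X" using h by auto
  fix U assume U: "openin X U"
  have UX: "U \<subseteq> topspace X" using U by (rule openin_subset)
  have SX: "?S \<subseteq> topspace X" unfolding side_def by blast
  show "openin X (?r -` U \<inter> topspace X)"
  proof (cases "h \<in> U")
    case False
    then have "?r -` U \<inter> topspace X = ?S \<inter> U" using SX by (auto split: if_splits)
    then show ?thesis using openin_side[OF h w] U by auto
  next
    case True
    let ?O = "\<Union>y\<in>topspace X - ?S - {h}. side X h y"
    have away: "z \<notin> ?S" if "y \<in> topspace X - ?S - {h}" "z \<in> side X h y" for y z
    proof
      assume "z \<in> ?S"
      then have "h \<notin> seg X w z" "h \<notin> seg X z y"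
        using that(2) unfolding side_def by (auto simp: seg_commute)
      then have "h \<notin> seg X w y" using not_in_seg_trans[OF h] by blast
      then show False using that(1) unfolding side_def by blast
    qed
    have cover: "z \<in> ?O" if "z \<in> topspace X" "z \<notin> ?S" "z \<noteq> h" for z
    proof -
      have "z \<in> side X h z" using that seg_singleton[OF that(1)] unfolding side_def by simp
      then show ?thesis using that by blast
    qed
    have OX: "?O \<subseteq> topspace X" unfolding side_def by blast
    have "?r -` U \<inter> topspace X = U \<union> ?O"
    proof (intro equalityI subsetI)
      fix z assume z: "z \<in> ?r -` U \<inter> topspace X"
      show "z \<in> U \<union> ?O"
      proof (cases "z \<in> ?S \<or> z = h")
        case True then show ?thesis using z \<open>h \<in> U\<close> by auto
      next
        case False then show ?thesis using cover z by blast
      qed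
    next
      fix z assume z: "z \<in> U \<union> ?O"
      then have "z \<in> topspace X" using UX OX by blast
      moreover have "?r z \<in> U"
      proof (cases "z \<in> ?S")
        case True
        then have "z \<notin> ?O" using away by blast
        then show ?thesis using z True by simp
      next
        case False then show ?thesis using \<open>h \<in> U\<close> by simp
      qed
      ultimately show "z \<in> ?r -` U \<inter> topspace X" by simp
    qed
    moreover have "openin X ?O" by (intro openin_Union) (auto intro: openin_side[OF h])
    ultimately show ?thesis using U by auto
  qed
qed

text \<open>
  A closed walk is shadowed by a point \<open>v\<close> with \<open>v \<le> w 0 = f\<^sup>N v\<close>. Branching prevents the intermediate value
  theorem from giving a fixed point of \<open>f\<^sup>N\<close> with the same itinerary. Instead \<open>f\<close> is replaced in each step by
  the map that agrees with \<open>f\<close> where the image is on the side of the next vertex and sends everything else to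
  \<open>h\<close>. The composition \<open>g N\<close> of these maps is continuous and still satisfies \<open>v \<le> g N v\<close>, so it has a fixed
  point \<open>t \<ge> v\<close>. A trajectory that drops to \<open>h\<close> stays there, since \<open>f h\<close> is on no side of a point of \<open>P\<close>;
  as \<open>t \<noteq> h\<close>, the trajectory of \<open>t\<close> never drops and is a trajectory of \<open>f\<close>.
\<close>

lemma closed_walk_gives_periodic_point:
  assumes f: "continuous_map X X f" and h: "h \<in> topspace X" and P: "P \<subseteq> topspace X" "h \<notin> P"
    "\<And>x. x \<in> P \<Longrightarrow> f x \<in> P" "\<And>w. w \<in> P \<Longrightarrow> h \<in> seg X (f h) w"
    and w: "\<forall>i\<le>N. w i \<in> P" "\<forall>i<N. w (Suc i) \<in> seg X h (f (w i))" "w N = w 0"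
  obtains t where "t \<in> topspace X" "(f ^^ N) t = t" "\<And>i. i \<le> N \<Longrightarrow> h \<notin> seg X (w i) ((f ^^ i) t)"
proof -
  have wX: "w i \<in> topspace X" if "i \<le> N" for i using w(1) P(1) that by blast
  have fX: "f x \<in> topspace X" if "x \<in> topspace X" for x using f that by (auto simp: continuous_map_def)
  obtain v where v: "\<forall>i\<le>N. (f ^^ i) v \<in> seg X h (w i) \<and> (f ^^ i) v \<noteq> h" "(f ^^ N) v = w N"
    using walk_is_shadowed[OF f h P w(1,2)] by blast
  have v0: "v \<in> seg X h (w 0)" "v \<noteq> h" using v(1) by force+
  have vX: "v \<in> topspace X" using v0 by (auto dest: seg_in_topspace)
  \<comment> \<open>follow \<open>f\<close>, but drop to \<open>h\<close> on leaving the prescribed side\<close>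
  define F where "F i z = (if f z \<in> side X h (w i) then f z else h)" for i z
  define g where "g = rec_nat (\<lambda>x. x) (\<lambda>i G x. F (Suc i) (G x))"
  have g0: "g 0 x = x" and gS: "g (Suc i) x = F (Suc i) (g i x)" for i x unfolding g_def by simp_all
  have Fcont: "continuous_map X X (F i)" if "i \<le> N" for i
    using continuous_map_compose[OF f continuous_map_collapse_to_side[OF h wX[OF that]]]
    unfolding F_def[abs_def] by (simp add: o_def)
  have gcont: "i \<le> N \<Longrightarrow> continuous_map X X (g i)" for i
  proof (induction i)
    case 0
    have "g 0 = id" using g0 by auto
    then show ?case using continuous_map_id[of X] by simp
  next
    case (Suc i)
    then have "continuous_map X X (F (Suc i) \<circ> g i)" using Fcont by (intro continuous_map_compose) auto
    moreover have "F (Suc i) \<circ> g i = g (Suc i)" using gS by auto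
    ultimately show ?case by simp
  qed
  have wside: "x \<in> side X h y" if x: "x \<in> seg X h y" "x \<noteq> h" "y \<in> topspace X" for x y
  proof -
    have "h \<notin> seg X y x" using seg_antisym[OF x(3), of h x] x(1,2) by (auto simp: seg_commute)
    then show ?thesis using seg_in_topspace[OF x(1)] unfolding side_def by blast
  qed
  have gv: "i \<le> N \<Longrightarrow> g i v = (f ^^ i) v" for i
  proof (induction i)
    case (Suc i)
    have "(f ^^ Suc i) v \<in> side X h (w (Suc i))"
      using wside[OF _ _ wX[OF Suc.prems]] v(1) Suc.prems by blast
    then show ?case using Suc unfolding gS F_def by simp
  qed (simp add: g0)
  have "v \<in> seg X h (g N v)" using gv[of N] v(2) w(3) v0 by simp
  then obtain t q where t: "t \<in> topspace X" "v \<in> seg X h t" "t \<in> seg X h (g N t)"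
    and fix_t: "\<And>q. q \<in> topspace X \<Longrightarrow> t \<in> seg X (g N t) q"
    using maximal_expanding_point[OF h gcont[OF order_refl] closedin_topspace vX _ vX
        endpoints_in_seg(2)[OF h vX]] by metis
  have "g N t \<in> topspace X" using gcont[of N] t(1) by (auto simp: continuous_map_def)
  then have gt: "g N t = t" using fix_t[of "g N t"] seg_singleton[of "g N t" X] by auto
  have th: "t \<noteq> h" using t(2) v0(2) seg_singleton[OF h] by auto
  have Fh: "F i h = h" if "i \<le> N" for i
    using P(4) w(1) that seg_commute unfolding F_def side_def by fastforce
  have stay: "g (i + k) t = h" if "g i t = h" "i + k \<le> N" for i k
    using that(2)
  proof (induction k)
    case (Suc k) then show ?case using gS[of "i + k" t] Fh[of "Suc (i + k)"] by simp
  qed (simp add: that(1))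
  have nh: "g i t \<noteq> h" if "i \<le> N" for i
    using stay[of i "N - i"] that gt th by auto
  have orb: "i \<le> N \<Longrightarrow> g i t = (f ^^ i) t" for i
  proof (induction i)
    case (Suc i)
    then have "g (Suc i) t = f (g i t)" using nh[OF Suc.prems] gS[of i t] unfolding F_def by presburger
    then show ?case using Suc by simp
  qed (simp add: g0)
  have side_pos: "h \<notin> seg X (w i) ((f ^^ i) t)" if i: "0 < i" "i \<le> N" for i
  proof -
    obtain j where j: "i = Suc j" using i(1) by (cases i) auto
    have "g i t \<in> side X h (w i)" using nh[OF i(2)] gS[of j t] j unfolding F_def by (metis (full_types))
    then show ?thesis using orb[OF i(2)] unfolding side_def by simp
  qed
  have "(f ^^ N) t = t" using orb[of N] gt by simp
  moreover have "h \<notin> seg X (w i) ((f ^^ i) t)" if "i \<le> N" for i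
  proof (cases "i = 0")
    case True
    show ?thesis
    proof (cases "N = 0")
      case False
      then show ?thesis using True side_pos[of N] w(3) \<open>(f ^^ N) t = t\<close> by simp
    next
      case N0: True
      have "v = w 0" using v(2) N0 by simp
      then have "w 0 \<in> seg X h t" using t(2) by simp
      then have "h \<notin> seg X t (w 0)" using seg_antisym[OF t(1), of h "w 0"] v0(2) \<open>v = w 0\<close> by (auto simp: seg_commute)
      then show ?thesis using True by (simp add: seg_commute)
    qed
  next
    case False then show ?thesis using side_pos that by simp
  qed
  ultimately show ?thesis using that t(1) by blast
qed

end

text \<open>
  Beyond every point of \<open>M\<close> there is a maximal point of the tree, which separates nothing and is therefore an
  end point. The points below a given end point form a chain, so incomparable points have different end
  points beyond them.
\<close>

lemma antichain_card_le_End: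
  assumes tree: "topological_tree X" and h: "h \<in> topspace X" and M: "M \<subseteq> topspace X" "h \<notin> M"
    and anti: "\<And>x y. x \<in> M \<Longrightarrow> y \<in> M \<Longrightarrow> x \<in> seg X h y \<Longrightarrow> x = y"
  shows "finite M" "card M \<le> End X"
proof -
  interpret dendrite X by (rule dendrite_topological_tree[OF tree])
  let ?E = "{x \<in> topspace X. has_valence X x 1}"
  have "\<exists>e\<in>?E. x \<in> seg X h e" if x: "x \<in> M" for x
  proof -
    have xX: "x \<in> topspace X" "x \<noteq> h" using x M by blast+
    have "\<exists>m\<in>{b \<in> topspace X. x \<in> seg X h b}. \<forall>y\<in>{b \<in> topspace X. x \<in> seg X h b}. m \<in> seg X h y \<longrightarrow> y = m"
    proof (rule maximal_point_exists[OF h])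
      show "{b \<in> topspace X. x \<in> seg X h b} \<noteq> {}" using endpoints_in_seg(2)[OF h xX(1)] xX(1) by blast
      fix C m assume C: "C \<subseteq> {b \<in> topspace X. x \<in> seg X h b}" "C \<noteq> {}" "chain_limit X h C m"
      then obtain c where "c \<in> C" by blast
      then have "c \<in> seg X h m" "m \<in> topspace X" "x \<in> seg X h c" using C unfolding chain_limit_def by blast+
      then show "m \<in> {b \<in> topspace X. x \<in> seg X h b}" using seg_trans[OF h] by blast
    qed blast
    then obtain m where m: "m \<in> topspace X" "x \<in> seg X h m"
      and max: "\<And>y. y \<in> topspace X \<Longrightarrow> x \<in> seg X h y \<Longrightarrow> m \<in> seg X h y \<Longrightarrow> y = m" by blast
    have top: "y = m" if "y \<in> topspace X" "m \<in> seg X h y" for y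
      using max[OF that(1) seg_trans[OF h that(1) m(2) that(2)] that(2)] .
    have "has_valence X m 1"
    proof (rule endpoint_if_not_separating[OF tree m(1)])
      fix a b assume ab: "a \<in> topspace X" "b \<in> topspace X" "a \<noteq> m" "b \<noteq> m"
      have "m \<notin> seg X a h" "m \<notin> seg X h b" using top ab by (auto simp: seg_commute)
      then show "m \<notin> seg X a b" using not_in_seg_trans[OF m(1)] by blast
    qed
    then show ?thesis using m by blast
  qed
  then obtain e where e: "\<And>x. x \<in> M \<Longrightarrow> e x \<in> ?E \<and> x \<in> seg X h (e x)" by metis
  have "inj_on e M"
  proof (rule inj_onI)
    fix x y assume xy: "x \<in> M" "y \<in> M" "e x = e y"
    have "e x \<in> topspace X" using e[OF xy(1)] by blast
    then have "x \<in> seg X h y \<or> y \<in> seg X h x"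
      using seg_linear[OF h, of "e x" x y] e[OF xy(1)] e[OF xy(2)] xy(3) by simp
    then show "x = y" using anti xy(1,2) by metis
  qed
  moreover have "e ` M \<subseteq> ?E" using e by blast
  moreover have fin: "finite ?E" by (rule finite_endpoints[OF tree])
  ultimately show "finite M" "card M \<le> End X"
    unfolding End_def by (meson finite_subset inj_on_finite, meson card_inj_on_le)
qed

section \<open>Cycles of prime period\<close>

lemma finite_self_map_has_short_cycle:
  assumes "finite M" "m \<in> M" "\<And>x. x \<in> M \<Longrightarrow> \<psi> x \<in> M"
  obtains y l where "y \<in> M" "0 < l" "l \<le> card M" "(\<psi> ^^ l) y = y"
proof -
  have it: "(\<psi> ^^ i) m \<in> M" for i by (induction i) (auto simp: assms)
  have "card ((\<lambda>i. (\<psi> ^^ i) m) ` {..card M}) \<le> card M"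
    by (rule card_mono[OF assms(1)]) (use it in blast)
  then have "\<not> inj_on (\<lambda>i. (\<psi> ^^ i) m) {..card M}" by (metis card_atMost card_image lessI not_le)
  then obtain i j where "i \<le> card M" "j \<le> card M" "i \<noteq> j" "(\<psi> ^^ i) m = (\<psi> ^^ j) m"
    unfolding inj_on_def by auto
  then obtain i j where ij: "i < j" "j \<le> card M" "(\<psi> ^^ i) m = (\<psi> ^^ j) m"
    by (metis linorder_neqE_nat)
  have "(\<psi> ^^ (j - i)) ((\<psi> ^^ i) m) = (\<psi> ^^ (j - i + i)) m" by (simp add: funpow_add)
  then have "(\<psi> ^^ (j - i)) ((\<psi> ^^ i) m) = (\<psi> ^^ i) m" using ij by simp
  then show ?thesis using that[OF it, of "j - i" i] ij by simp
qed

lemma funpow_periodic_mod: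
  assumes "(f ^^ p) x = x" shows "(f ^^ (p * k + i)) x = (f ^^ i) x"
proof -
  have "(f ^^ (p * k)) x = x" using assms by (induction k) (simp_all add: funpow_add)
  then show ?thesis by (metis add.commute comp_apply funpow_add)
qed

text \<open>
  A cycle has \<open>n\<close> elements precisely when \<open>n\<close> is the least period of its points.
\<close>

lemma has_cycle_of_period_iff:
  assumes "0 < n"
  shows "has_cycle_of_period X f n \<longleftrightarrow>
    (\<exists>x\<in>topspace X. (f ^^ n) x = x \<and> (\<forall>d. 0 < d \<and> d < n \<longrightarrow> (f ^^ d) x \<noteq> x))"
proof -
  have least: "\<exists>d>0. (f ^^ d) x = x \<and> (\<forall>e. 0 < e \<and> e < d \<longrightarrow> (f ^^ e) x \<noteq> x)" 
    if "periodic_point f x" for x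
    using exists_least_iff[of "\<lambda>d. 0 < d \<and> (f ^^ d) x = x"] that unfolding periodic_point_def by blast
  have card: "card (orbit f x) = d"
    if d: "0 < d" "(f ^^ d) x = x" "\<forall>e. 0 < e \<and> e < d \<longrightarrow> (f ^^ e) x \<noteq> x" for x d
  proof -
    have red: "(f ^^ i) x = (f ^^ (i mod d)) x" for i
      using funpow_periodic_mod[OF d(2), of "i div d" "i mod d"] by simp
    have "orbit f x = (\<lambda>i. (f ^^ i) x) ` {..<d}"
    proof
      show "orbit f x \<subseteq> (\<lambda>i. (f ^^ i) x) ` {..<d}"
      proof
        fix y assume "y \<in> orbit f x"
        then obtain i where "y = (f ^^ i) x" unfolding orbit_altdef by blast
        then have "y = (f ^^ (i mod d)) x" using red by metis
        then show "y \<in> (\<lambda>i. (f ^^ i) x) ` {..<d}" using d(1) by simp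
      qed
      show "(\<lambda>i. (f ^^ i) x) ` {..<d} \<subseteq> orbit f x"
      proof
        fix y assume "y \<in> (\<lambda>i. (f ^^ i) x) ` {..<d}"
        then obtain i where "y = (f ^^ i) x" by blast
        then have "y = (f ^^ (d * 1 + i)) x" using funpow_periodic_mod[OF d(2)] by metis
        then show "y \<in> orbit f x" unfolding orbit_altdef using d(1) by auto
      qed
    qed
    moreover have "inj_on (\<lambda>i. (f ^^ i) x) {..<d}"
    proof (rule linorder_inj_onI')
      fix i j assume ij: "i \<in> {..<d}" "j \<in> {..<d}" "i < j"
      show "(f ^^ i) x \<noteq> (f ^^ j) x"
      proof
        assume "(f ^^ i) x = (f ^^ j) x"
        then have "(f ^^ (d - j)) ((f ^^ i) x) = (f ^^ (d - j)) ((f ^^ j) x)" by simp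
        then have "(f ^^ (d - j + i)) x = (f ^^ (d - j + j)) x" by (simp only: funpow_add o_apply)
        then have "(f ^^ (d - j + i)) x = x" using ij d(2) by simp
        moreover have "0 < d - j + i" "d - j + i < d" using ij by auto
        ultimately show False using d(3) by blast
      qed
    qed
    ultimately show ?thesis by (simp add: card_image)
  qed
  show ?thesis
  proof
    assume "has_cycle_of_period X f n"
    then obtain x where x: "x \<in> topspace X" "periodic_point f x" "card (orbit f x) = n"
      unfolding has_cycle_of_period_def is_cycle_def by blast
    obtain d where d: "0 < d" "(f ^^ d) x = x" "\<forall>e. 0 < e \<and> e < d \<longrightarrow> (f ^^ e) x \<noteq> x"
      using least[OF x(2)] by blast
    then have "d = n" using card[OF d] x(3) by simp
    then show "\<exists>x\<in>topspace X. (f ^^ n) x = x \<and> (\<forall>d. 0 < d \<and> d < n \<longrightarrow> (f ^^ d) x \<noteq> x)"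
      using d x(1) by blast
  next
    assume "\<exists>x\<in>topspace X. (f ^^ n) x = x \<and> (\<forall>d. 0 < d \<and> d < n \<longrightarrow> (f ^^ d) x \<noteq> x)"
    then obtain x where x: "x \<in> topspace X" "(f ^^ n) x = x" "\<forall>d. 0 < d \<and> d < n \<longrightarrow> (f ^^ d) x \<noteq> x"
      by blast
    then have "periodic_point f x" "card (orbit f x) = n"
      using assms card[OF assms x(2,3)] unfolding periodic_point_def by blast+
    then show "has_cycle_of_period X f n"
      using x(1) unfolding has_cycle_of_period_def is_cycle_def by blast
  qed
qed

lemma tree_has_second_point:
  assumes "topological_tree X" "h \<in> topspace X"
  shows "\<exists>v\<in>topspace X. v \<noteq> h"
proof -
  obtain n where n: "has_valence X h n"
    using assms unfolding topological_tree_def topological_graph_def by blast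
  then obtain U g where ch: "1 \<le> n" "openin X U" "h \<in> U"
    "homeomorphic_map (subtopology X U) (top_of_set (open_star n)) g" "g h = 0"
    unfolding has_valence_def by blast
  obtain k e where k: "continuous_map (top_of_set (open_star n)) X k" "inj_on k (open_star n)" "k 0 = h"
    "k ` open_star n = U" "\<forall>z\<in>open_star n. g (k z) = z" "\<forall>y\<in>U. k (g y) = y"
    "0 < e" "e < 1" "\<forall>z\<in>open_star n. cmod z < e \<longrightarrow> k z \<in> U"
    "openin X (k ` (open_star n \<inter> ball 0 e))"
    using chart_ball[OF ch(2,3) ch(2,3,4,5)] .
  have z: "of_real (1/2) * cis (2 * pi * real 0 / real n) \<in> open_star n"
    by (rule star_point_in) (use ch(1) in auto)
  have "0 \<in> open_star n" using star_point_in[of 0 0 n] ch(1) by simp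
  then have "k (of_real (1/2) * cis (2 * pi * real 0 / real n)) \<noteq> h"
    using inj_onD[OF k(2) _ z, of 0] k(3) by auto
  moreover have "k (of_real (1/2) * cis (2 * pi * real 0 / real n)) \<in> topspace X"
    using k(4) z openin_subset[OF ch(2)] by blast
  ultimately show ?thesis by blast
qed

lemma End_pos:
  assumes tree: "topological_tree X" shows "1 \<le> End X"
proof -
  obtain h where h: "h \<in> topspace X" using tree unfolding topological_tree_def by blast
  obtain v where "v \<in> topspace X" "v \<noteq> h" using tree_has_second_point[OF tree h] by blast
  then show ?thesis using antichain_card_le_End(2)[OF tree h, of "{v}"] by auto
qed

text \<open>
  Take a pivot \<open>h\<close> for the cycle \<open>P\<close> and the order with root \<open>h\<close>. The graph with the arrows \<open>w' \<le> f w\<close>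
  contains the cycle itself, a closed walk of length \<open>p\<close>. It also contains a closed walk of length
  \<open>l \<le> End X\<close>: the minimal points of \<open>P\<close> form an antichain, hence are at most \<open>End X\<close> in number, and every
  minimal \<open>m\<close> has an arrow to a minimal point \<open>\<psi> m \<le> f m\<close>; a finite self-map has a short cycle. Both walks
  pass through a common \<open>y\<close>, and a suitable concatenation of copies of them is a closed walk of length \<open>N\<close>.

  It yields a point with \<open>f\<^sup>N t = t\<close> whose iterates visit the components of the complement of \<open>h\<close> in the same
  order as the walk. If the least period of \<open>t\<close> were a proper divisor of \<open>N\<close>, then by the combinatorics
  of words all points of \<open>P\<close> would lie in one component, while \<open>h\<close> separates two of them.
\<close>

lemma prime_period_forces_large_periods:
  assumes tree: "topological_tree X" and f: "continuous_map X X f"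
    and p: "prime p" "End X < p" and x: "x \<in> topspace X" "(f ^^ p) x = x" "f x \<noteq> x"
    and N: "2 * End X * (p - 1) < N"
  shows "\<exists>t\<in>topspace X. (f ^^ N) t = t \<and> (\<forall>d. 0 < d \<and> d < N \<longrightarrow> (f ^^ d) t \<noteq> t)"
proof -
  interpret dendrite X by (rule dendrite_topological_tree[OF tree])
  have fX: "f z \<in> topspace X" if "z \<in> topspace X" for z
    using f that by (auto simp: continuous_map_def)
  have p0: "0 < p" using p(1) by (rule prime_gt_0_nat)
  define P where "P = (\<lambda>i. (f ^^ i) x) ` {..<p}"
  have red: "(f ^^ i) x = (f ^^ (i mod p)) x" for i
    using funpow_periodic_mod[OF x(2), of "i div p" "i mod p"] by simp
  have orbP: "(f ^^ i) x \<in> P" for i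
    unfolding P_def by (subst red) (use p0 in \<open>auto intro!: imageI\<close>)
  have Pf: "f z \<in> P" if "z \<in> P" for z
  proof -
    obtain i where "z = (f ^^ i) x" using \<open>z \<in> P\<close> unfolding P_def by blast
    then have "f z = (f ^^ Suc i) x" by simp
    then show ?thesis using orbP by metis
  qed
  have PX: "P \<subseteq> topspace X"
  proof -
    have "(f ^^ i) x \<in> topspace X" for i by (induction i) (auto simp: x fX)
    then show ?thesis unfolding P_def by blast
  qed
  have Pfin: "finite P" unfolding P_def by simp
  have xP: "x \<in> P" using orbP[of 0] by simp
  have reach: "\<exists>i<p. z' = (f ^^ i) z" if zz: "z \<in> P" "z' \<in> P" for z z'
  proof -
    obtain i j where ij: "i < p" "z = (f ^^ i) x" "j < p" "z' = (f ^^ j) x" using zz unfolding P_def by blast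
    have "(f ^^ ((p - i + j) mod p)) z = (f ^^ ((p - i + j) mod p + i)) x" unfolding ij(2) by (simp add: funpow_add)
    also have "\<dots> = (f ^^ (((p - i + j) mod p + i) mod p)) x" by (rule red)
    also have "((p - i + j) mod p + i) mod p = (p - i + j + i) mod p" by (simp add: mod_add_left_eq)
    also have "\<dots> = j" using ij(1,3) by simp
    finally have "z' = (f ^^ ((p - i + j) mod p)) z" using ij(4) by simp
    then show ?thesis using p0 by (intro exI[of _ "(p - i + j) mod p"]) simp
  qed
  have Pp: "(f ^^ p) z = z" if "z \<in> P" for z
  proof -
    obtain i where "z = (f ^^ i) x" using \<open>z \<in> P\<close> unfolding P_def by blast
    then have "(f ^^ p) z = (f ^^ (p * 1 + i)) x" by (simp add: funpow_add)
    then show ?thesis using funpow_periodic_mod[OF x(2), of 1 i] \<open>z = (f ^^ i) x\<close> by simp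
  qed
  have nofix: "f z \<noteq> z" if "z \<in> P" for z
  proof
    assume "f z = z"
    then have stay: "(f ^^ i) z = z" for i by (induction i) auto
    have "x = z" using reach[OF \<open>z \<in> P\<close> xP] stay by auto
    then show False using x(3) \<open>f z = z\<close> by simp
  qed
  obtain h x1 x2 where h: "h \<in> topspace X" "h \<notin> P" and away: "\<And>w. w \<in> P \<Longrightarrow> h \<in> seg X (f h) w"
    and x12: "x1 \<in> P" "x2 \<in> P" "h \<in> seg X x1 x2"
    using pivot_exists[OF f Pfin _ PX Pf nofix] xP by blast
  \<comment> \<open>two points of the cycle on different sides of \<open>h\<close> are incomparable\<close>
  have E2: "2 \<le> End X"
  proof -
    have X12: "x1 \<in> topspace X" "x2 \<in> topspace X" using x12 PX by blast+
    have ne: "x1 \<noteq> x2" using x12 h(2) seg_singleton[OF X12(1)] by auto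
    have "x1 \<notin> seg X h x2" using seg_antisym[OF X12(2), of h x1] x12 h(2) by (auto simp: seg_commute)
    moreover have "x2 \<notin> seg X h x1" using seg_antisym[OF X12(1), of h x2] x12 h(2) by (auto simp: seg_commute)
    ultimately have "card {x1, x2} \<le> End X"
      using h(2) x12 X12 by (intro antichain_card_le_End(2)[OF tree h(1)]) auto
    then show ?thesis using ne by simp
  qed
  \<comment> \<open>the points of the cycle nearest to \<open>h\<close>\<close>
  define M where "M = {m \<in> P. \<forall>z\<in>P. z \<in> seg X h m \<longrightarrow> z = m}"
  have M: "finite M" "card M \<le> End X" 
    using antichain_card_le_End[OF tree h(1), of M] PX h(2) unfolding M_def by blast+
  have below: "\<exists>m\<in>M. m \<in> seg X h w" if w: "w \<in> P" for w
  proof -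
    let ?Q = "\<lambda>m. m \<in> P \<and> m \<in> seg X h w"
    have "?Q w" using w endpoints_in_seg(2)[OF h(1)] PX by blast
    then obtain m where m: "?Q m" "\<And>z. ?Q z \<Longrightarrow> card {y \<in> P. y \<in> seg X h m} \<le> card {y \<in> P. y \<in> seg X h z}"
      using ex_has_least_nat[of ?Q w "\<lambda>z. card {y \<in> P. y \<in> seg X h z}"] by blast
    have mX: "m \<in> topspace X" and wX: "w \<in> topspace X" using m(1) w PX by blast+
    have "z = m" if z: "z \<in> P" "z \<in> seg X h m" for z
    proof (rule ccontr)
      assume ne: "z \<noteq> m"
      have "?Q z" using z seg_trans[OF h(1) wX z(2)] m(1) by blast
      have "{y \<in> P. y \<in> seg X h z} \<subseteq> {y \<in> P. y \<in> seg X h m}"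
        using seg_trans[OF h(1) mX _ z(2)] by blast
      moreover have "m \<notin> seg X h z" using seg_antisym[OF h(1) _ z(2)] ne by blast
      moreover have "m \<in> seg X h m" by (rule endpoints_in_seg(2)[OF h(1) mX])
      ultimately have "{y \<in> P. y \<in> seg X h z} \<subset> {y \<in> P. y \<in> seg X h m}" using m(1) by blast
      then have "card {y \<in> P. y \<in> seg X h z} < card {y \<in> P. y \<in> seg X h m}"
        using Pfin by (intro psubset_card_mono) auto
      then show False using m(2)[OF \<open>?Q z\<close>] by simp
    qed
    then show ?thesis using m(1) unfolding M_def by blast
  qed
  have MP: "M \<subseteq> P" unfolding M_def by blast
  have "\<forall>m\<in>M. \<exists>m'\<in>M. m' \<in> seg X h (f m)" using below Pf MP by blast
  then obtain \<psi> where psi: "\<And>m. m \<in> M \<Longrightarrow> \<psi> m \<in> M \<and> \<psi> m \<in> seg X h (f m)" by metis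
  obtain m0 where "m0 \<in> M" using below[OF xP] by blast
  then obtain y l where y: "y \<in> M" "0 < l" "l \<le> card M" "(\<psi> ^^ l) y = y"
    using finite_self_map_has_short_cycle[OF M(1), of m0 \<psi>] psi by blast
  have psiM: "(\<psi> ^^ i) y \<in> M" for i by (induction i) (auto simp: y psi)
  have yP: "y \<in> P" using y(1) MP by blast
  have fyP: "(f ^^ i) y \<in> P" for i by (induction i) (auto simp: yP Pf)
  have lp: "l < p" "l \<le> End X" using y(3) M(2) p(2) by auto
  have p3: "3 \<le> p" using p(2) E2 by simp
  have cop: "coprime p l"
    using p(1) lp(1) y(2) by (metis coprime_commute dvd_imp_le not_le prime_imp_coprime)
  have "2 * l * (p - 1) \<le> 2 * End X * (p - 1)" "4 * (p - 1) \<le> 2 * End X * (p - 1)"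
    using lp(2) E2 by (intro mult_le_mono1; simp)+
  then have Nl: "2 * l * (p - 1) < N" "4 * (p - 1) < N" using N by linarith+
  obtain A B where AB: "N = A + B" "p dvd A" "l dvd B" "0 < A" "0 < B" "3 * (p + l) \<le> N + 6"
    "(p + l \<le> A + 1 \<and> p + l \<le> B + 1) \<or> N + 2 * l \<le> 2 * B + 2"
    using two_block_decomposition[OF cop y(2) lp(1) p3 Nl] by blast
  \<comment> \<open>copies of the cycle up to time \<open>A\<close>, then copies of the short closed walk up to time \<open>A + B = N\<close>\<close>
  define w where "w i = (if i < A then (f ^^ i) y else (\<psi> ^^ (i - A)) y)" for i
  have fA: "(f ^^ A) y = y"
  proof -
    obtain k where "A = p * k" using AB(2) by blast
    then show ?thesis using funpow_periodic_mod[OF Pp[OF yP], of k 0] by simp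
  qed
  have psiB: "(\<psi> ^^ B) y = y"
  proof -
    obtain k where "B = l * k" using AB(3) by blast
    then show ?thesis using funpow_periodic_mod[OF y(4), of k 0] by simp
  qed
  have wP: "w i \<in> P" for i unfolding w_def using fyP psiM MP by auto
  have wstep: "w (Suc i) \<in> seg X h (f (w i))" for i
  proof -
    have self: "z \<in> seg X h z" if "z \<in> P" for z using that PX endpoints_in_seg(2)[OF h(1)] by blast
    consider "Suc i < A" | "Suc i = A" | "A \<le> i" by linarith
    then show ?thesis
    proof cases
      case 1 then show ?thesis unfolding w_def using self[OF fyP[of "Suc i"]] by simp
    next
      case 2 
      then have "f (w i) = y" unfolding w_def using fA by auto
      then show ?thesis unfolding w_def using 2 self[OF yP] by simp
    next
      case 3
      then show ?thesis unfolding w_def using psi[OF psiM[of "i - A"]] by (simp add: Suc_diff_le)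
    qed
  qed
  have wN: "w N = w 0" unfolding w_def using AB(1,4) psiB by simp
  obtain t where t: "t \<in> topspace X" "(f ^^ N) t = t" "\<And>i. i \<le> N \<Longrightarrow> h \<notin> seg X (w i) ((f ^^ i) t)"
    using closed_walk_gives_periodic_point[OF f h(1) PX h(2) Pf away, of N w] wP wstep wN by blast
  have "(f ^^ d) t \<noteq> t" if d: "0 < d" "d < N" for d
  proof
    assume "(f ^^ d) t = t"
    then obtain c where c: "0 < c" "(f ^^ c) t = t" "\<And>e. 0 < e \<Longrightarrow> e < c \<Longrightarrow> (f ^^ e) t \<noteq> t"
      using exists_least_iff[of "\<lambda>d. 0 < d \<and> (f ^^ d) t = t"] d(1) by blast
    have cN: "c < N" using c(3)[OF d(1)] \<open>(f ^^ d) t = t\<close> d(2) by (meson not_le_imp_less order_le_less_trans)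
    have "c dvd N"
    proof -
      have "(f ^^ (N mod c)) t = t"
        using funpow_periodic_mod[OF c(2), of "N div c" "N mod c"] t(2) by simp
      then have "N mod c = 0" using c(3)[of "N mod c"] c(1) by (meson gr0I mod_less_divisor)
      then show ?thesis by blast
    qed
    \<comment> \<open>the itinerary of \<open>t\<close>, which inherits the period \<open>c\<close>\<close>
    define u where "u i = side X h ((f ^^ i) t)" for i
    have uw: "u i = side X h (w i)" if "i \<le> N" for i
      unfolding u_def using side_eqI[OF h(1) t(3)[OF that]] by simp
    have "u i = u 0" if "i < p" for i
    proof (rule two_block_word_primitive[where A = A and B = B and N = N and d = c and p = p and l = l])
      show "u (i + c) = u i" for i 
        using funpow_periodic_mod[OF c(2), of 1 i] unfolding u_def by (simp add: add.commute)
      show "periodic_on u 0 A p" 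
        unfolding periodic_on_def
      proof (intro allI impI)
        fix i assume i: "i + p < A"
        have "w (i + p) = w i" unfolding w_def using i funpow_periodic_mod[OF Pp[OF yP], of 1 i] by (simp add: add.commute)
        then show "u (0 + i + p) = u (0 + i)" using uw[of "i + p"] uw[of i] i AB(1) by simp
      qed
      show "periodic_on u A B l"
        unfolding periodic_on_def
      proof (intro allI impI)
        fix i assume i: "i + l < B"
        have "w (A + i + l) = w (A + i)" unfolding w_def using funpow_periodic_mod[OF y(4), of 1 i] by (simp add: add.commute)
        then show "u (A + i + l) = u (A + i)" using uw[of "A + i + l"] uw[of "A + i"] i AB(1) by simp
      qed
    qed (use c(1) \<open>c dvd N\<close> cN AB cop y(2) lp(1) that in auto)
    moreover have "u i = side X h ((f ^^ i) y)" if "i < p" for i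
    proof -
      have "i < A" using that AB(2,4) by (meson dvd_imp_le order_less_le_trans)
      then show ?thesis using uw[of i] AB(1) unfolding w_def by simp
    qed
    ultimately have same: "side X h ((f ^^ i) y) = side X h y" if "i < p" for i
      using that p0 by (metis funpow_0)
    have "side X h x1 = side X h x2"
      using reach[OF yP x12(1)] reach[OF yP x12(2)] same by metis
    moreover have "x2 \<in> side X h x2"
      using x12(2) PX h(2) seg_singleton[of x2 X] unfolding side_def by auto
    ultimately show False using x12(3) unfolding side_def by blast
  qed
  then show ?thesis using t by blast
qed

theorem corollary2:
  fixes X :: "'a topology" and f :: "'a \<Rightarrow> 'a" and p :: nat
  assumes "topological_tree X"
    and "p = (LEAST q. prime q \<and> End X < q)"
    and "continuous_map X X f"
    and "\<forall>n \<in> {1..2 * End X * (p - 1)}. has_cycle_of_period X f n"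
  shows "\<forall>n \<ge> 1. has_cycle_of_period X f n"
proof (intro allI impI)
  fix N :: nat
  assume N: "1 \<le> N"
  have E: "1 \<le> End X" by (rule End_pos[OF assms(1)])
  have "\<exists>q. prime q \<and> End X < q" using bigger_prime by blast
  then have p: "prime p" "End X < p" unfolding assms(2) by (rule LeastI2_ex; blast)+
  show "has_cycle_of_period X f N"
  proof (cases "N \<le> 2 * End X * (p - 1)")
    case True
    then show ?thesis using assms(4) N by auto
  next
    case False
    have p2: "2 \<le> p" using p(1) by (rule prime_ge_2_nat)
    have "p \<le> 2 * (p - 1)" using p2 by linarith
    also have "\<dots> \<le> 2 * End X * (p - 1)" using E by (intro mult_le_mono1) simp
    finally have "has_cycle_of_period X f p" using assms(4) p2 by auto
    then obtain x where x: "x \<in> topspace X" "(f ^^ p) x = x" "\<forall>d. 0 < d \<and> d < p \<longrightarrow> (f ^^ d) x \<noteq> x"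
      using has_cycle_of_period_iff[of p X f] p2 by auto
    have "f x \<noteq> x" using x(3)[rule_format, of 1] p2 by simp
    then have "\<exists>t\<in>topspace X. (f ^^ N) t = t \<and> (\<forall>d. 0 < d \<and> d < N \<longrightarrow> (f ^^ d) t \<noteq> t)"
      using prime_period_forces_large_periods[OF assms(1,3) p x(1,2)] False by simp
    then show ?thesis using has_cycle_of_period_iff[of N X f] N by simp
  qed
qed

end
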